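(* Let $G$ be a compactly generated locally compact group, let $(\pi,\mathcal H)$ be an orthogonal or unitary representation of $G$, and let $\mu$ be a cohomologically adapted probability measure on $G$. Let $b\in Z^1(G,\pi)$ and let $P_{\mathrm{Har}}b$ be its orthogonal projection on $\mathrm{Har}_\mu(G,\pi)$. (i) If $\operatorname{span}\big((P_{\mathrm{Har}}b)(G)\big)$ is dense in $\mathcal H$, then the affine isometric action $\alpha_{\pi,b}$ is irreducible. (ii) Assume that $B^1(G,\pi)$ is closed in $Z^1(G,\pi)$. If the affine isometric action $\alpha_{\pi,b}$ is irreducible, then $\operatorname{span}\big((P_{\mathrm{Har}}b)(G)\big)$ is dense in $\mathcal H$.
   Context: Representations are strongly continuous: $(\pi,\mathcal H)$ is a continuous unitary (resp. orthogonal) representation of $G$ on a complex (resp. real) Hilbert space $\mathcal H$. A $1$-cocycle with coefficients in $\pi$ is a continuous map $b:G\to\mathcal H$ with $b(gh)=b(g)+\pi(g)b(h)$ for all $g,h\in G$; $Z^1(G,\pi)$ is the vector space of $1$-cocycles. For $v\in\mathcal H$ let $\partial_v(g)=\pi(g)v-v$; $B^1(G,\pi)=\{\partial_v:v\in\mathcal H\}$ is the space of coboundaries. $Z^1(G,\pi)$ carries the topology of uniform convergence on compact subsets of $G$. Fix a compact symmetric neighbourhood $Q$ of the identity generating $G$ and put $|g|_Q=\min\{n\in\mathbb N: g\in Q^n\}$. A probability measure $\mu$ on $G$ is cohomologically adapted if: $\mu$ is symmetric (invariant under $x\mapsto x^{-1}$); $\mu$ is absolutely continuous with respect to Haar measure;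 the support of $\mu$ generates $G$; and $\int_G|x|_Q^2\,d\mu(x)<\infty$. (This does not depend on the choice of $Q$.) For such $\mu$, $L^2(G,\mathcal H,\mu)$ is the Hilbert space of measurable maps $F:G\to\mathcal H$ with $\int_G\|F(x)\|^2d\mu(x)<\infty$. $Z^1(G,\pi)$ is a closed subspace of $L^2(G,\mathcal H,\mu)$, and the $L^2$-norm induces on $Z^1(G,\pi)$ the topology of uniform convergence on compact sets. A cocycle $b\in Z^1(G,\pi)$ is $\mu$-harmonic if $\int_G b(x)\,d\mu(x)=0$; $\mathrm{Har}_\mu(G,\pi)$ is the (closed) space of $\mu$-harmonic cocycles in $Z^1(G,\pi)$, and $P_{\mathrm{Har}}:L^2(G,\mathcal H,\mu)\to\mathrm{Har}_\mu(G,\pi)$ is the orthogonal projection. For $b\in Z^1(G,\pi)$, $\alpha_{\pi,b}$ is the affine isometric action of $G$ on $\mathcal H$ given by $\alpha_{\pi,b}(g)v=\pi(g)v+b(g)$. An affine isometric action $\alpha$ of $G$ on a real or complex Hilbert space $\mathcal H$ is irreducible if $\mathcal H$ has no non-empty, closed and proper $\alpha(G)$-invariant affine subspace. *)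

theory Defs
  imports "HOL-Probability.Probability"
begin

section \<open>Real and complex Hilbert spaces\<close>

text \<open>
  The scalar field is either the reals (orthogonal representations) or the complex numbers
  (unitary representations).  By the Gelfand--Mazur theorem the class below has, up to
  isomorphism, no members besides its two instances.
\<close>

class real_or_complex = real_normed_field + banach + second_countable_topology +
  fixes scalar_cnj :: "'a \<Rightarrow> 'a"
  assumes scalar_cnj_add: "scalar_cnj (x + y) = scalar_cnj x + scalar_cnj y"
    and scalar_cnj_mult: "scalar_cnj (x * y) = scalar_cnj x * scalar_cnj y"
    and scalar_cnj_involution: "scalar_cnj (scalar_cnj x) = x"
    and mult_scalar_cnj: "x * scalar_cnj x = (norm x)\<^sup>2 *\<^sub>R 1"

instantiation real :: real_or_complex
begin

definition scalar_cnj_real :: "real \<Rightarrow> real" where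
  "scalar_cnj_real x = x"

instance
  by standard (simp_all add: scalar_cnj_real_def power2_eq_square)

end

instantiation complex :: real_or_complex
begin

definition scalar_cnj_complex :: "complex \<Rightarrow> complex" where
  "scalar_cnj_complex z = cnj z"

instance
proof
  fix x y :: complex
  show "x * scalar_cnj x = (norm x)\<^sup>2 *\<^sub>R 1"
    unfolding scalar_cnj_complex_def scaleR_conv_of_real mult_1_right
    by (rule complex_norm_square[symmetric])
qed (simp_all add: scalar_cnj_complex_def)

end

text \<open>
  The type class \<open>real_inner\<close> carries the underlying real Hilbert space, \<open>ip\<close> is the inner product
  with values in the scalar field, linear in its first argument.  By polarization, \<open>norm_ip\<close> makes
  \<open>x \<bullet> y\<close> the real part of \<open>ip x y\<close>.
\<close>

locale hilbert_space = vector_space smul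
  for smul :: "'k::real_or_complex \<Rightarrow> 'h::{real_inner, banach} \<Rightarrow> 'h" +
  fixes ip :: "'h \<Rightarrow> 'h \<Rightarrow> 'k"
  assumes scale_of_real: "smul (of_real r) x = r *\<^sub>R x"
    and ip_add_left: "ip (x + y) z = ip x z + ip y z"
    and ip_scale_left: "ip (smul c x) y = c * ip x y"
    and ip_commute: "ip y x = scalar_cnj (ip x y)"
    and norm_ip: "of_real ((norm x)\<^sup>2) = ip x x"

lemma hilbert_space_real:
  "hilbert_space scaleR (inner :: 'h::{real_inner, banach} \<Rightarrow> 'h \<Rightarrow> real)"
proof (rule hilbert_space.intro[OF real_vector.vector_space_axioms], rule hilbert_space_axioms.intro)
  fix x y z :: 'h and r c :: real
  show "of_real r *\<^sub>R x = r *\<^sub>R x"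
    by (simp only: of_real_eq_id id_apply)
  show "(x + y) \<bullet> z = x \<bullet> z + y \<bullet> z"
    by (rule inner_add_left)
  show "(c *\<^sub>R x) \<bullet> y = c * (x \<bullet> y)"
    by (rule inner_scaleR_left)
  show "y \<bullet> x = scalar_cnj (x \<bullet> y)"
    unfolding scalar_cnj_real_def by (rule inner_commute)
  show "of_real ((norm x)\<^sup>2) = x \<bullet> x"
    by (simp only: of_real_eq_id id_apply power2_norm_eq_inner)
qed

lemma hilbert_space_complex:
  "hilbert_space ((*) :: complex \<Rightarrow> complex \<Rightarrow> complex) (\<lambda>z w. z * cnj w)"
proof (rule hilbert_space.intro, unfold_locales)
  fix a x y z :: complex and r :: real
  show "of_real r * x = r *\<^sub>R x"
    by (rule scaleR_conv_of_real[symmetric])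
  show "(x + y) * cnj z = x * cnj z + y * cnj z" "a * x * cnj y = a * (x * cnj y)"
    by (rule distrib_right mult.assoc)+
  show "y * cnj x = scalar_cnj (x * cnj y)"
    by (simp only: scalar_cnj_complex_def complex_cnj_mult complex_cnj_cnj mult.commute)
  show "of_real ((norm x)\<^sup>2) = x * cnj x"
    by (rule complex_norm_square)
qed

definition affine_subspace ::
  "('k::real_or_complex \<Rightarrow> 'h::{real_inner, banach} \<Rightarrow> 'h) \<Rightarrow> 'h set \<Rightarrow> bool" where
  "affine_subspace smul A \<longleftrightarrow> (\<exists>v W. module.subspace smul W \<and> A = (\<lambda>w. v + w) ` W)"


section \<open>Topological groups, length functions and Haar measure\<close>

text \<open>
  Groups are written additively, following the library class \<open>topological_group_add\<close>; that class
  does not assume commutativity.  Locally compact groups are taken to be Hausdorff.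
\<close>

definition generates :: "'g::group_add set \<Rightarrow> bool" where
  "generates S \<longleftrightarrow>
    (\<lambda>H. 0 \<in> H \<and> (\<forall>x\<in>H. \<forall>y\<in>H. x + y \<in> H) \<and> (\<forall>x\<in>H. - x \<in> H)) hull S = UNIV"

definition compactly_generated :: "'g::{topological_group_add, t2_space} itself \<Rightarrow> bool" where
  "compactly_generated _ \<longleftrightarrow> (\<exists>K :: 'g set. compact K \<and> generates K)"

definition compact_generating_neighbourhood ::
  "'g::{topological_group_add, t2_space} set \<Rightarrow> bool" where
  "compact_generating_neighbourhood Q \<longleftrightarrow>
    compact Q \<and> uminus ` Q = Q \<and> 0 \<in> interior Q \<and> generates Q"

definition set_power :: "'g::group_add set \<Rightarrow> nat \<Rightarrow> 'g set" where
  "set_power Q n = {sum_list qs | qs. length qs = n \<and> set qs \<subseteq> Q}"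

definition word_length :: "'g::group_add set \<Rightarrow> 'g \<Rightarrow> nat" where
  "word_length Q g = (LEAST n. g \<in> set_power Q n)"

definition left_haar_measure :: "'g::{topological_group_add, t2_space} measure \<Rightarrow> bool" where
  "left_haar_measure \<nu> \<longleftrightarrow>
    sets \<nu> = sets borel \<and>
    emeasure \<nu> UNIV \<noteq> 0 \<and>
    (\<forall>g. \<forall>A\<in>sets borel. emeasure \<nu> ((\<lambda>x. g + x) ` A) = emeasure \<nu> A) \<and>
    (\<forall>K. compact K \<longrightarrow> emeasure \<nu> K < \<infinity>) \<and>
    (\<forall>A\<in>sets borel. emeasure \<nu> A = (INF U\<in>{U. open U \<and> A \<subseteq> U}. emeasure \<nu> U)) \<and>
    (\<forall>U. open U \<longrightarrow> emeasure \<nu> U = (SUP K\<in>{K. compact K \<and> K \<subseteq> U}. emeasure \<nu> K))"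

definition measure_support :: "'g::topological_space measure \<Rightarrow> 'g set" where
  "measure_support \<mu> = {x. \<forall>U. open U \<and> x \<in> U \<longrightarrow> emeasure \<mu> U \<noteq> 0}"

text \<open>
  Left Haar measures are unique up to a positive factor, so absolute continuity does not depend on
  the choice of \<open>\<nu>\<close>; left and right Haar measures have the same null sets.
\<close>

definition cohomologically_adapted ::
  "'g::{topological_group_add, t2_space} set \<Rightarrow> 'g measure \<Rightarrow> bool" where
  "cohomologically_adapted Q \<mu> \<longleftrightarrow>
    sets \<mu> = sets borel \<and>
    prob_space \<mu> \<and>
    distr \<mu> borel uminus = \<mu> \<and>
    (\<exists>\<nu>. left_haar_measure \<nu> \<and> absolutely_continuous \<nu> \<mu>) \<and>
    generates (measure_support \<mu>) \<and>
    (\<integral>\<^sup>+x. of_nat ((word_length Q x)\<^sup>2) \<partial>\<mu>) < \<infinity>"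


section \<open>Representations and cocycles\<close>

locale unitary_representation = hilbert_space smul ip
  for smul :: "'k::real_or_complex \<Rightarrow> 'h::{real_inner, banach} \<Rightarrow> 'h"
    and ip :: "'h \<Rightarrow> 'h \<Rightarrow> 'k" +
  fixes \<pi> :: "'g::{topological_group_add, t2_space} \<Rightarrow> 'h \<Rightarrow> 'h"
  assumes rep_linear: "Vector_Spaces.linear smul smul (\<pi> g)"
    and rep_zero: "\<pi> 0 = id"
    and rep_add: "\<pi> (g + h) = \<pi> g \<circ> \<pi> h"
    and rep_ip: "ip (\<pi> g x) (\<pi> g y) = ip x y"
    and rep_strongly_continuous: "continuous_on UNIV (\<lambda>g. \<pi> g v)"

definition cocycles ::
  "('g::{topological_group_add, t2_space} \<Rightarrow> 'h::{real_inner, banach} \<Rightarrow> 'h) \<Rightarrow> ('g \<Rightarrow> 'h) set" where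
  "cocycles \<pi> = {b. continuous_on UNIV b \<and> (\<forall>g h. b (g + h) = b g + \<pi> g (b h))}"

definition coboundary ::
  "('g::{topological_group_add, t2_space} \<Rightarrow> 'h::{real_inner, banach} \<Rightarrow> 'h) \<Rightarrow> 'h \<Rightarrow> 'g \<Rightarrow> 'h" where
  "coboundary \<pi> v = (\<lambda>g. \<pi> g v - v)"

definition coboundaries ::
  "('g::{topological_group_add, t2_space} \<Rightarrow> 'h::{real_inner, banach} \<Rightarrow> 'h) \<Rightarrow> ('g \<Rightarrow> 'h) set" where
  "coboundaries \<pi> = range (coboundary \<pi>)"

definition compact_convergence_topology ::
  "('a::topological_space \<Rightarrow> 'b::metric_space) topology" where
  "compact_convergence_topology = topology (\<lambda>U. \<forall>f\<in>U. \<exists>K e. compact K \<and> e > 0 \<and>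
     {f'. \<forall>x\<in>K. dist (f' x) (f x) < e} \<subseteq> U)"

lemma openin_compact_convergence_topology:
  "openin compact_convergence_topology U \<longleftrightarrow> (\<forall>f\<in>U. \<exists>K e. compact K \<and> e > 0 \<and>
     {f'. \<forall>x\<in>K. dist (f' x) (f x) < e} \<subseteq> U)"
proof -
  define N :: "('a \<Rightarrow> 'b) \<Rightarrow> 'a set \<Rightarrow> real \<Rightarrow> ('a \<Rightarrow> 'b) set"
    where "N f K e = {f'. \<forall>x\<in>K. dist (f' x) (f x) < e}" for f K e
  have N_Un: "N f (K \<union> L) (min d e) \<subseteq> N f K d \<inter> N f L e" for f K L d e
    by (auto simp: N_def)
  have "istopology (\<lambda>U. \<forall>f\<in>U. \<exists>K e. compact K \<and> e > 0 \<and> N f K e \<subseteq> U)"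
    unfolding istopology_def
  proof (intro conjI allI impI ballI)
    fix S T f
    assume S: "\<forall>f\<in>S. \<exists>K e. compact K \<and> e > 0 \<and> N f K e \<subseteq> S"
      and T: "\<forall>f\<in>T. \<exists>K e. compact K \<and> e > 0 \<and> N f K e \<subseteq> T"
      and f: "f \<in> S \<inter> T"
    obtain K d where K: "compact K" "d > 0" "N f K d \<subseteq> S"
      using bspec[OF S IntD1[OF f]] by (elim exE conjE)
    obtain L e where L: "compact L" "e > 0" "N f L e \<subseteq> T"
      using bspec[OF T IntD2[OF f]] by (elim exE conjE)
    have "compact (K \<union> L) \<and> min d e > 0 \<and> N f (K \<union> L) (min d e) \<subseteq> S \<inter> T"
      using order_trans[OF N_Un Int_mono[OF K(3) L(3)]] K(1,2) L(1,2) by (simp add: compact_Un)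
    then show "\<exists>K e. compact K \<and> e > 0 \<and> N f K e \<subseteq> S \<inter> T"
      by (intro exI[where x = "K \<union> L"] exI[where x = "min d e"])
  next
    fix \<U> f
    assume *: "\<forall>U\<in>\<U>. \<forall>f\<in>U. \<exists>K e. compact K \<and> e > 0 \<and> N f K e \<subseteq> U" and "f \<in> \<Union>\<U>"
    then obtain U where U: "U \<in> \<U>" "f \<in> U"
      by blast
    obtain K e where "compact K" "e > 0" "N f K e \<subseteq> U"
      using bspec[OF bspec[OF * U(1)] U(2)] by (elim exE conjE)
    with U(1) have "compact K \<and> e > 0 \<and> N f K e \<subseteq> \<Union>\<U>"
      by (simp add: Union_upper order_trans)
    then show "\<exists>K e. compact K \<and> e > 0 \<and> N f K e \<subseteq> \<Union>\<U>"
      by (intro exI[where x = K] exI[where x = e])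
  qed
  from fun_cong[OF topology_inverse'[OF this], of U] show ?thesis
    unfolding compact_convergence_topology_def N_def .
qed


section \<open>Harmonic cocycles and the harmonic projection\<close>

text \<open>
  The Bochner integral.  The library's \<open>has_bochner_integral\<close> has the same definition but is
  restricted to second countable (that is, separable) target spaces.
\<close>

definition has_vector_integral :: "'a measure \<Rightarrow> ('a \<Rightarrow> 'h::{real_inner, banach}) \<Rightarrow> 'h \<Rightarrow> bool" where
  "has_vector_integral M f v \<longleftrightarrow> f \<in> borel_measurable M \<and>
    (\<exists>s. (\<forall>i::nat. Bochner_Integration.simple_bochner_integrable M (s i)) \<and>
      (\<lambda>i. \<integral>\<^sup>+x. ennreal (norm (f x - s i x)) \<partial>M) \<longlonglongrightarrow> 0 \<and>
      (\<lambda>i. Bochner_Integration.simple_bochner_integral M (s i)) \<longlonglongrightarrow> v)"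

lemma has_vector_integral_iff_has_bochner_integral:
  fixes f :: "'a \<Rightarrow> 'h::{real_inner, banach, second_countable_topology}"
  shows "has_vector_integral M f v \<longleftrightarrow> has_bochner_integral M f v"
  unfolding has_vector_integral_def has_bochner_integral.simps by (simp only: ex_simps)

definition harmonic_cocycles ::
  "'g::{topological_group_add, t2_space} measure \<Rightarrow> ('g \<Rightarrow> 'h::{real_inner, banach} \<Rightarrow> 'h) \<Rightarrow>
    ('g \<Rightarrow> 'h) set" where
  "harmonic_cocycles \<mu> \<pi> = {b \<in> cocycles \<pi>. has_vector_integral \<mu> b 0}"

definition l2_inner ::
  "('h \<Rightarrow> 'h \<Rightarrow> 'k::real_or_complex) \<Rightarrow> 'g measure \<Rightarrow> ('g \<Rightarrow> 'h) \<Rightarrow> ('g \<Rightarrow> 'h) \<Rightarrow> 'k" where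
  "l2_inner ip \<mu> F F' = (\<integral>x. ip (F x) (F' x) \<partial>\<mu>)"

text \<open>
  Elements of \<open>L\<^sup>2\<close> are represented by functions.  The description is nevertheless unique: for a
  cohomologically adapted \<open>\<mu>\<close>, cocycles that agree almost everywhere are equal, since a closed
  subgroup of full measure contains the support of \<open>\<mu>\<close>.
\<close>

definition harmonic_projection ::
  "('h \<Rightarrow> 'h \<Rightarrow> 'k::real_or_complex) \<Rightarrow> 'g::{topological_group_add, t2_space} measure \<Rightarrow>
    ('g \<Rightarrow> 'h::{real_inner, banach} \<Rightarrow> 'h) \<Rightarrow> ('g \<Rightarrow> 'h) \<Rightarrow> 'g \<Rightarrow> 'h" where
  "harmonic_projection ip \<mu> \<pi> F =
    (THE P. P \<in> harmonic_cocycles \<mu> \<pi> \<and>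
      (\<forall>h\<in>harmonic_cocycles \<mu> \<pi>. l2_inner ip \<mu> (\<lambda>x. F x - P x) h = 0))"


section \<open>Affine isometric actions\<close>

definition affine_action ::
  "('g::{topological_group_add, t2_space} \<Rightarrow> 'h::{real_inner, banach} \<Rightarrow> 'h) \<Rightarrow> ('g \<Rightarrow> 'h) \<Rightarrow>
    'g \<Rightarrow> 'h \<Rightarrow> 'h" where
  "affine_action \<pi> b g v = \<pi> g v + b g"

definition irreducible_action ::
  "('k::real_or_complex \<Rightarrow> 'h::{real_inner, banach} \<Rightarrow> 'h) \<Rightarrow> ('g \<Rightarrow> 'h \<Rightarrow> 'h) \<Rightarrow> bool" where
  "irreducible_action smul \<alpha> \<longleftrightarrow>
    \<not> (\<exists>A. affine_subspace smul A \<and> A \<noteq> {} \<and> closed A \<and> A \<noteq> UNIV \<and> (\<forall>g. \<alpha> g ` A \<subseteq> A))"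

end

theory Submission
  imports Defs
begin

text \<open>
  Write \<open>\<partial> v\<close> for the coboundary of \<open>v\<close>.  Symmetry of \<open>\<mu>\<close> and the cocycle identity give
  \<open>\<integral> b x \<bullet> \<partial> v x = - 2 (\<integral> b x) \<bullet> v\<close> (\<open>integral_inner_coboundary\<close>), so the harmonic cocycles are exactly
  those orthogonal to all coboundaries, and \<open>Z\<^sup>1\<close> is the orthogonal sum of the harmonic cocycles and
  the closure of the coboundaries.

  For this decomposition the \<open>L\<^sup>2\<close>-norm has to be equivalent to uniform convergence on compact
  sets.  One direction is the growth of cocycles, \<open>norm (c x) \<le> word_length Q x * M\<close> with \<open>M\<close> a bound
  on \<open>Q\<close>, together with the finite second moment.  For the other, let \<open>c\<close> have \<open>L\<^sup>2\<close>-norm less than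
  \<open>s\<close>.  By Chebyshev's inequality \<open>c\<close> is bounded by a multiple of \<open>s\<close> off a set of small measure.
  Absolute continuity enters through a form of Steinhaus' theorem
  (\<open>steinhaus_absolutely_continuous\<close>): all differences of points of a set of almost full measure
  fill a neighbourhood of the identity that does not depend on the set.  Since \<open>norm (c (x - y))\<close> is at
  most \<open>norm (c x) + norm (c y)\<close>, this bounds \<open>c\<close> near the identity, and because the support of \<open>\<mu>\<close>
  generates the group, also at every point and on every compact set (\<open>bounded_on_compact\<close>).

  The main tool is \<open>harmonic_part_exists\<close>: a cocycle \<open>b\<close> with values in a closed invariant subspace
  \<open>W\<close> has a harmonic part that also takes values in \<open>W\<close> and differs from \<open>b\<close> by a limit of
  coboundaries of vectors of \<open>W\<close>.  It is obtained by minimising the norm of \<open>b + \<partial> w\<close> over \<open>w \<in> W\<close>.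
  By \<open>harmonic_projection_eqI\<close> it is the projection of \<open>b\<close>.

  For the first claim, an invariant closed affine subspace \<open>v + W\<close> makes \<open>W\<close> invariant under \<open>\<pi>\<close> and
  \<open>b + \<partial> v\<close> a cocycle with values in \<open>W\<close>.  Its harmonic part lies in \<open>W\<close> and is also the harmonic
  part of \<open>b\<close>, so density of the span forces \<open>W\<close> to be the whole space.  For the second claim, closedness
  of the coboundaries gives \<open>b = P - \<partial> w\<close> with \<open>P\<close> the harmonic part, and then \<open>w + W\<close>, with \<open>W\<close> the
  closed span of \<open>P\<close>, is an invariant closed affine subspace.
\<close>

section \<open>Real and scalar-valued inner products\<close>

context hilbert_space
begin

lemma scalar_cnj_norm_square: "scalar_cnj z * z = of_real ((norm z)\<^sup>2)" for z :: 'k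
  using mult_scalar_cnj[of z] by (simp add: mult.commute scaleR_conv_of_real)

lemma norm_scalar_cnj: "norm (scalar_cnj z) = norm z" for z :: 'k
proof (cases "z = 0")
  case True
  then show ?thesis using scalar_cnj_add[of 0 0] by simp
next
  case False
  have "norm (scalar_cnj z) * norm z = (norm z)\<^sup>2"
    using arg_cong[OF scalar_cnj_norm_square, of norm z]
    by (simp add: norm_mult norm_power del: of_real_power)
  with False show ?thesis by (simp add: power2_eq_square)
qed

lemma scalar_cnj_of_real: "scalar_cnj (of_real r :: 'k) = of_real r"
proof (cases "r = 0")
  case True
  then show ?thesis using norm_scalar_cnj[of 0] by simp
next
  case False
  have "scalar_cnj (of_real r :: 'k) * of_real r = of_real r * of_real r"
    unfolding scalar_cnj_norm_square by (simp add: power2_eq_square)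
  with False show ?thesis by simp
qed

lemma bounded_linear_scalar_cnj: "bounded_linear (scalar_cnj :: 'k \<Rightarrow> 'k)"
  by (rule bounded_linear_intro[where K = 1])
    (simp_all add: scalar_cnj_add scaleR_conv_of_real scalar_cnj_mult scalar_cnj_of_real norm_scalar_cnj)

lemma ip_add_right: "ip x (y + z) = ip x y + ip x z"
  by (metis ip_add_left ip_commute scalar_cnj_add)

lemma ip_scale_right: "ip x (smul c y) = scalar_cnj c * ip x y"
  by (metis ip_commute ip_scale_left scalar_cnj_mult)

lemma of_real_inner: "of_real (2 * (x \<bullet> y)) = ip x y + ip y x"
proof -
  have "2 * (x \<bullet> y) = (norm (x + y))\<^sup>2 - (norm x)\<^sup>2 - (norm y)\<^sup>2"
    by (simp add: power2_norm_eq_inner inner_add_left inner_add_right inner_commute)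
  then have "of_real (2 * (x \<bullet> y)) = ip (x + y) (x + y) - ip x x - ip y y"
    by (simp only: of_real_diff norm_ip)
  then show ?thesis
    by (simp add: ip_add_left ip_add_right)
qed

text \<open>
  Twisting one argument by the conjugate of the scalar product makes that product real, which
  reduces the Cauchy--Schwarz inequality for \<open>ip\<close> to the one for the real inner product.
\<close>

lemma inner_scale_cnj_ip: "smul (scalar_cnj (ip x y)) x \<bullet> y = (norm (ip x y))\<^sup>2"
proof -
  define z where "z = ip x y"
  have 1: "ip (smul (scalar_cnj z) x) y = of_real ((norm z)\<^sup>2)"
    by (simp add: ip_scale_left z_def scalar_cnj_norm_square)
  have 2: "ip y (smul (scalar_cnj z) x) = of_real ((norm z)\<^sup>2)"
    unfolding ip_scale_right ip_commute[of y x] z_def[symmetric] scalar_cnj_involution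
    by (simp only: mult.commute[of z] scalar_cnj_norm_square)
  have "of_real (2 * (smul (scalar_cnj z) x \<bullet> y)) = (of_real (2 * (norm z)\<^sup>2) :: 'k)"
    unfolding of_real_inner 1 2 by simp
  then show ?thesis
    unfolding of_real_eq_iff z_def by simp
qed

lemma inner_smul_left: "smul c x \<bullet> y = x \<bullet> smul (scalar_cnj c) y"
proof -
  have "(of_real (2 * (smul c x \<bullet> y)) :: 'k) = of_real (2 * (x \<bullet> smul (scalar_cnj c) y))"
    unfolding of_real_inner by (simp add: ip_scale_left ip_scale_right scalar_cnj_involution)
  then show ?thesis
    unfolding of_real_eq_iff by simp
qed

lemma norm_smul: "norm (smul c x) = norm c * norm x"
proof -
  have "of_real ((norm (smul c x))\<^sup>2) = scalar_cnj c * c * ip x x"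
    by (simp add: norm_ip ip_scale_left ip_scale_right mult_ac del: of_real_power)
  also have "\<dots> = of_real ((norm c * norm x)\<^sup>2)"
    by (simp only: scalar_cnj_norm_square norm_ip[symmetric] power_mult_distrib of_real_mult)
  finally have "(norm (smul c x))\<^sup>2 = (norm c * norm x)\<^sup>2"
    unfolding of_real_eq_iff .
  then show ?thesis
    by (simp add: power2_eq_iff_nonneg)
qed

lemma norm_ip_le: "norm (ip x y) \<le> norm x * norm y"
proof (cases "ip x y = 0")
  case False
  have "norm (ip x y) * norm (ip x y) \<le> norm (smul (scalar_cnj (ip x y)) x) * norm y"
    unfolding power2_eq_square[symmetric] inner_scale_cnj_ip[symmetric] by (rule norm_cauchy_schwarz)
  with False show ?thesis
    by (simp add: norm_smul norm_scalar_cnj)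
qed simp

lemma bounded_bilinear_ip: "bounded_bilinear ip"
proof
  fix x y z :: 'h and r :: real
  show "ip (x + y) z = ip x z + ip y z" "ip x (y + z) = ip x y + ip x z"
    by (simp_all add: ip_add_left ip_add_right)
  show "ip x (r *\<^sub>R y) = r *\<^sub>R ip x y"
    by (simp add: scale_of_real[symmetric] ip_scale_right scalar_cnj_of_real scaleR_conv_of_real)
  show "ip (r *\<^sub>R x) y = r *\<^sub>R ip x y"
    by (simp add: scale_of_real[symmetric] ip_scale_left scaleR_conv_of_real)
  show "\<exists>K. \<forall>x y. norm (ip x y) \<le> norm x * norm y * K"
    using norm_ip_le by (metis mult_1_right)
qed

lemma bounded_linear_smul: "bounded_linear (smul c)"
proof (rule bounded_linear_intro)
  fix x y :: 'h and r :: real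
  show "smul c (x + y) = smul c x + smul c y"
    by (rule scale_right_distrib)
  show "smul c (r *\<^sub>R x) = r *\<^sub>R smul c x"
    by (simp add: scale_of_real[symmetric] mult.commute)
  show "norm (smul c x) \<le> norm x * norm c"
    by (simp add: norm_smul mult.commute)
qed

lemma real_subspace: "subspace W \<Longrightarrow> Real_Vector_Spaces.subspace W"
  unfolding subspace_def Real_Vector_Spaces.subspace_def by (simp flip: scale_of_real)

lemma subspace_closure:
  assumes "subspace W"
  shows "subspace (closure W)"
proof (rule subspaceI)
  show "0 \<in> closure W"
    using assms closure_subset by (auto simp: subspace_def)
next
  fix x y assume "x \<in> closure W" "y \<in> closure W"
  then obtain f g where "\<And>n. f n \<in> W" "f \<longlonglongrightarrow> x" "\<And>n. g n \<in> W" "g \<longlonglongrightarrow> y"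
    by (auto simp: closure_sequential)
  then show "x + y \<in> closure W"
    using assms by (auto simp: closure_sequential subspace_def intro!: exI[of _ "\<lambda>n. f n + g n"] tendsto_add)
next
  fix c x assume "x \<in> closure W"
  then obtain f where "\<And>n. f n \<in> W" "f \<longlonglongrightarrow> x"
    by (auto simp: closure_sequential)
  then show "smul c x \<in> closure W"
    using assms bounded_linear.tendsto[OF bounded_linear_smul, of f x sequentially c]
    by (auto simp: closure_sequential subspace_def intro!: exI[of _ "\<lambda>n. smul c (f n)"])
qed

end

section \<open>Minimising sequences of quadratic functions\<close>

text \<open>
  This is the variational argument behind orthogonal projections, without completeness.  With
  \<open>\<Phi> v = c + 2 L v + B v v\<close> and \<open>\<Phi> (v n)\<close> tending to the infimum of \<open>\<Phi>\<close> on \<open>S\<close>, the parallelogram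
  law makes \<open>v\<close> a Cauchy sequence, and comparing \<open>\<Phi> (v n)\<close> with \<open>\<Phi> (v n + t w)\<close> makes the
  derivative \<open>L w + B (v n) w\<close> tend to zero.
\<close>

lemma quadratic_minimizing_sequence:
  fixes B :: "'v::real_vector \<Rightarrow> 'v \<Rightarrow> real" and L :: "'v \<Rightarrow> real" and c :: real
  assumes S: "subspace S"
    and L: "linear L" and B: "\<And>y. linear (\<lambda>x. B x y)" and sym: "\<And>x y. B x y = B y x"
    and B_nonneg: "\<And>x. 0 \<le> B x x"
    and bdd: "\<And>v. v \<in> S \<Longrightarrow> 0 \<le> c + 2 * L v + B v v"
  obtains v :: "nat \<Rightarrow> 'v" where "\<And>n. v n \<in> S"
    and "\<And>e. e > 0 \<Longrightarrow> \<exists>N. \<forall>m\<ge>N. \<forall>n\<ge>N. B (v m - v n) (v m - v n) < e"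
    and "\<And>w. w \<in> S \<Longrightarrow> (\<lambda>n. L w + B (v n) w) \<longlonglongrightarrow> 0"
proof -
  have Badd: "B (x + y) z = B x z + B y z" "B z (x + y) = B z x + B z y"
    and Bdiff: "B (x - y) z = B x z - B y z" "B z (x - y) = B z x - B z y"
    and Bscale: "B (r *\<^sub>R x) z = r * B x z" "B z (r *\<^sub>R x) = r * B z x" for x y z r
    using linear_add[OF B] linear_diff[OF B] linear_scale[OF B] by (simp_all add: sym[of z])
  define \<Phi> where "\<Phi> v = c + 2 * L v + B v v" for v
  define d where "d = Inf (\<Phi> ` S)"
  have bdd': "bdd_below (\<Phi> ` S)"
    using bdd by (auto simp: \<Phi>_def intro!: bdd_belowI)
  have d_le: "d \<le> \<Phi> v" if "v \<in> S" for v
    unfolding d_def by (rule cInf_lower) (use that bdd' in auto)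
  have "\<exists>v\<in>S. \<Phi> v < d + 1 / Suc n" for n
    using cInf_lessD[of "\<Phi> ` S" "d + 1 / Suc n"] subspace_0[OF S] unfolding d_def by force
  then obtain v where vS: "v n \<in> S" and v: "\<Phi> (v n) < d + 1 / Suc n" for n
    by metis
  show ?thesis
  proof
    show "v n \<in> S" for n by (rule vS)
    fix e :: real assume "e > 0"
    obtain N where N: "4 / Suc N < e"
      using reals_Archimedean[of "e / 4"] \<open>e > 0\<close> by (auto simp: field_simps)
    have "B (v m - v n) (v m - v n) < e" if "m \<ge> N" "n \<ge> N" for m n
    proof -
      define u where "u = (1/2) *\<^sub>R (v m + v n)"
      have "u \<in> S"
        unfolding u_def using S vS by (intro subspace_scale subspace_add)
      have "B (v m - v n) (v m - v n) = 2 * \<Phi> (v m) + 2 * \<Phi> (v n) - 4 * \<Phi> u"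
        unfolding \<Phi>_def u_def linear_add[OF L] linear_scale[OF L] Badd Bdiff Bscale
        by (simp add: sym algebra_simps)
      also have "\<dots> \<le> 2 * (\<Phi> (v m) - d) + 2 * (\<Phi> (v n) - d)"
        using d_le[OF \<open>u \<in> S\<close>] by simp
      also have "\<dots> \<le> 2 * (1 / Suc m) + 2 * (1 / Suc n)"
        using v[of m] v[of n] by simp
      also have "\<dots> \<le> 2 * (1 / Suc N) + 2 * (1 / Suc N)"
        using that by (intro add_mono mult_left_mono divide_left_mono) auto
      also have "\<dots> < e" using N by simp
      finally show ?thesis .
    qed
    then show "\<exists>N. \<forall>m\<ge>N. \<forall>n\<ge>N. B (v m - v n) (v m - v n) < e" by blast
  next
    fix w assume "w \<in> S"
    define \<beta> where "\<beta> = B w w + 1"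
    have \<beta>: "\<beta> > 0" using B_nonneg[of w] by (simp add: \<beta>_def)
    have *: "(L w + B (v n) w)\<^sup>2 \<le> \<beta> * (1 / Suc n)" for n
    proof -
      define a where "a = L w + B (v n) w"
      \<comment> \<open>The step minimises \<open>2 t a + t\<^sup>2 \<beta>\<close>.\<close>
      define t where "t = - a / \<beta>"
      have "d \<le> \<Phi> (v n + t *\<^sub>R w)"
        using S vS \<open>w \<in> S\<close> by (intro d_le subspace_scale subspace_add)
      also have "\<dots> = \<Phi> (v n) + 2 * t * a + t\<^sup>2 * B w w"
        unfolding \<Phi>_def a_def linear_add[OF L] linear_scale[OF L] Badd Bdiff Bscale sym[of w "v n"]
        by (simp add: algebra_simps power2_eq_square)
      also have "\<dots> \<le> \<Phi> (v n) + 2 * t * a + t\<^sup>2 * \<beta>"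
        by (simp add: \<beta>_def algebra_simps)
      also have "\<dots> = \<Phi> (v n) - a\<^sup>2 / \<beta>"
        using \<beta> by (simp add: t_def field_simps power2_eq_square)
      finally have "a\<^sup>2 / \<beta> \<le> 1 / Suc n"
        using v[of n] by simp
      then show ?thesis
        using \<beta> by (simp add: a_def field_simps)
    qed
    have lim: "(\<lambda>n. \<beta> * (1 / Suc n)) \<longlonglongrightarrow> 0"
      using tendsto_mult[OF tendsto_const[of \<beta>] LIMSEQ_Suc[OF lim_1_over_n]] by simp
    have "(\<lambda>n. (L w + B (v n) w)\<^sup>2) \<longlonglongrightarrow> 0"
      by (rule tendsto_sandwich[OF _ _ tendsto_const lim]) (use * in \<open>auto intro!: always_eventually\<close>)
    then show "(\<lambda>n. L w + B (v n) w) \<longlonglongrightarrow> 0"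
      using tendsto_real_sqrt[of "\<lambda>n. (L w + B (v n) w)\<^sup>2" 0 sequentially]
      by (simp add: tendsto_rabs_zero_iff)
  qed
qed

section \<open>Vector-valued integrals\<close>

text \<open>
  Differences of measurable functions need not be measurable when the target space is not separable;
  here the finitely many values of \<open>s\<close> reduce the claim to differences with constants.
\<close>

lemma borel_measurable_norm_diff_simple:
  fixes f :: "'a \<Rightarrow> 'h::real_normed_vector"
  assumes f: "f \<in> borel_measurable M" and s: "simple_function M s"
  shows "(\<lambda>x. norm (f x - s x)) \<in> borel_measurable M"
proof (rule measurable_compose_countable'[where f = "\<lambda>y x. norm (f x - y)" and g = s and I = "s ` space M"])
  show "(\<lambda>x. norm (f x - y)) \<in> borel_measurable M" for y
    by (rule measurable_compose[OF f borel_measurable_continuous_onI]) (intro continuous_intros)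
  show "s \<in> measurable M (count_space (s ` space M))"
    using s by (simp add: measurable_count_space_eq2 simple_function_def)
  show "countable (s ` space M)"
    using s by (simp add: simple_function_def countable_finite)
qed

lemma has_vector_integral_inner:
  assumes "has_vector_integral M f m"
  shows "has_bochner_integral M (\<lambda>x. f x \<bullet> v) (m \<bullet> v)"
proof -
  obtain s where f: "f \<in> borel_measurable M"
    and s: "\<And>i. Bochner_Integration.simple_bochner_integrable M (s i)"
    and conv: "(\<lambda>i. \<integral>\<^sup>+x. ennreal (norm (f x - s i x)) \<partial>M) \<longlonglongrightarrow> 0"
    and lim: "(\<lambda>i. Bochner_Integration.simple_bochner_integral M (s i)) \<longlonglongrightarrow> m"
    using assms unfolding has_vector_integral_def by auto
  have sf: "simple_function M (s i)" for i
    using s by (auto elim: Bochner_Integration.simple_bochner_integrable.cases)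
  show ?thesis
  proof (rule has_bochner_integral.intros)
    show "(\<lambda>x. f x \<bullet> v) \<in> borel_measurable M"
      by (rule measurable_compose[OF f borel_measurable_continuous_onI]) (intro continuous_intros)
    show "Bochner_Integration.simple_bochner_integrable M (\<lambda>x. s i x \<bullet> v)" for i
      by (rule simple_bochner_integrable_compose2[where p = "\<lambda>x y. x \<bullet> v", OF _ s s]) simp
    have "Bochner_Integration.simple_bochner_integral M (\<lambda>x. s i x \<bullet> v) =
        Bochner_Integration.simple_bochner_integral M (s i) \<bullet> v" for i
      by (rule simple_bochner_integral_linear[OF _ s])
        (simp add: bounded_linear.linear bounded_linear_inner_left)
    then show "(\<lambda>i. Bochner_Integration.simple_bochner_integral M (\<lambda>x. s i x \<bullet> v)) \<longlonglongrightarrow> m \<bullet> v"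
      using tendsto_inner[OF lim tendsto_const] by simp
    have *: "(\<integral>\<^sup>+x. ennreal (norm (f x \<bullet> v - s i x \<bullet> v)) \<partial>M) \<le>
        ennreal (norm v) * (\<integral>\<^sup>+x. ennreal (norm (f x - s i x)) \<partial>M)" for i
    proof -
      have "(\<integral>\<^sup>+x. ennreal (norm (f x \<bullet> v - s i x \<bullet> v)) \<partial>M) \<le>
          (\<integral>\<^sup>+x. ennreal (norm v) * ennreal (norm (f x - s i x)) \<partial>M)"
        by (intro nn_integral_mono)
          (simp add: inner_diff_left[symmetric] ennreal_mult[symmetric] mult.commute[of "norm v"]
            Cauchy_Schwarz_ineq2)
      also have "\<dots> = ennreal (norm v) * (\<integral>\<^sup>+x. ennreal (norm (f x - s i x)) \<partial>M)"
        using borel_measurable_norm_diff_simple[OF f sf]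
        by (intro nn_integral_cmult) simp
      finally show ?thesis .
    qed
    have "(\<lambda>i. ennreal (norm v) * (\<integral>\<^sup>+x. ennreal (norm (f x - s i x)) \<partial>M)) \<longlonglongrightarrow> ennreal (norm v) * 0"
      by (rule ennreal_tendsto_cmult[OF _ conv]) simp
    then have lim': "(\<lambda>i. ennreal (norm v) * (\<integral>\<^sup>+x. ennreal (norm (f x - s i x)) \<partial>M)) \<longlonglongrightarrow> 0"
      by simp
    show "(\<lambda>i. \<integral>\<^sup>+x. ennreal (norm (f x \<bullet> v - s i x \<bullet> v)) \<partial>M) \<longlonglongrightarrow> 0"
      by (rule tendsto_sandwich[OF _ _ tendsto_const lim']) (use * in \<open>auto intro!: always_eventually\<close>)
  qed
qed

text \<open>
  A function that is continuous on a \<open>\<sigma>\<close>-compact space has separable range, so the Bochner integral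
  exists although the target space may be non-separable.  The approximating simple functions take
  values in the range of \<open>f\<close>, which keeps the integral in any closed subspace containing it.
\<close>

lemma simple_function_approximation:
  fixes f :: "'g::t2_space \<Rightarrow> 'h::real_normed_vector" and K :: "nat \<Rightarrow> 'g set"
  assumes M: "sets M = sets borel" and fin: "finite_measure M"
    and f: "continuous_on UNIV f"
    and K: "\<And>n. compact (K n)" "incseq K" "(\<Union>n. K n) = UNIV"
    and int: "integrable M (\<lambda>x. norm (f x))"
    and e: "e > 0"
  obtains s where "Bochner_Integration.simple_bochner_integrable M s"
    and "range s \<subseteq> insert 0 (range f)"
    and "(\<integral>\<^sup>+x. ennreal (norm (f x - s x)) \<partial>M) \<le> ennreal e"
proof -
  interpret finite_measure M by fact
  have sp[simp]: "space M = UNIV"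
    using sets_eq_imp_space_eq[OF M] by simp
  have f_meas: "f \<in> borel_measurable M"
    using borel_measurable_continuous_onI[OF f] M by (simp cong: measurable_cong_sets)
  have K_meas[measurable]: "K n \<in> sets M" "- K n \<in> sets M" for n
    using K(1) M by (simp_all add: compact_imp_closed borel_open open_Compl)
  have norm_meas[measurable]: "(\<lambda>x. norm (f x)) \<in> borel_measurable M"
    using int by auto
  have tail_meas: "(\<lambda>x. indicator (- K n) x * norm (f x)) \<in> borel_measurable M" for n
    by measurable
  have "(\<lambda>n. LINT x|M. indicator (- K n) x * norm (f x)) \<longlonglongrightarrow> (LINT x|M. 0)"
  proof (rule integral_dominated_convergence[where w = "\<lambda>x. norm (f x)"])
    show "AE x in M. (\<lambda>n. indicator (- K n) x * norm (f x)) \<longlonglongrightarrow> 0"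
    proof (rule AE_I2)
      fix x
      obtain N where "x \<in> K N" using K(3) by blast
      then have "\<forall>n\<ge>N. indicator (- K n) x * norm (f x) = 0"
        using incseqD[OF K(2)] by (auto simp: indicator_def)
      then show "(\<lambda>n. indicator (- K n) x * norm (f x)) \<longlonglongrightarrow> 0"
        by (intro tendsto_eventually) (auto simp: eventually_sequentially)
    qed
  qed (use int tail_meas in \<open>auto simp: indicator_def\<close>)
  then obtain n where n: "(LINT x|M. indicator (- K n) x * norm (f x)) < e / 2"
    using e by (force dest!: order_tendstoD(2)[where a = "e / 2"] simp: eventually_sequentially)
  \<comment> \<open>On \<open>K n\<close> the function is approximated up to \<open>\<delta>\<close> by a finite net, off \<open>K n\<close> by \<open>0\<close>.
    The index of the first net point that is close enough depends measurably on the argument.\<close>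
  define \<delta> where "\<delta> = e / (2 * (measure M UNIV + 1))"
  have \<delta>: "\<delta> > 0" using e by (simp add: \<delta>_def add_nonneg_pos)
  have "compact (f ` K n)"
    using K(1) f by (intro compact_continuous_image) (auto intro: continuous_on_subset)
  then obtain D where D: "finite D" "D \<subseteq> f ` K n" "f ` K n \<subseteq> (\<Union>d\<in>D. ball d \<delta>)"
    using seq_compact_imp_totally_bounded[of "f ` K n"] \<delta> by (auto simp: compact_eq_seq_compact_metric)
  obtain ds where ds: "set ds = D" using finite_list[OF D(1)] by blast
  define idx where "idx x = (if x \<in> K n then LEAST j. dist (f x) (ds ! j) < \<delta> \<or> length ds \<le> j
    else length ds)" for x
  define s where "s x = (if idx x < length ds then ds ! idx x else 0)" for x
  have idx_le: "idx x \<le> length ds" for x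
    by (auto simp: idx_def intro: Least_le)
  have idx_less: "idx x < length ds \<and> dist (f x) (ds ! idx x) < \<delta>" if "x \<in> K n" for x
  proof -
    have "f x \<in> (\<Union>d\<in>D. ball d \<delta>)"
      using D(3) that by blast
    then obtain d where "d \<in> D" "dist (f x) d < \<delta>"
      by (auto simp: dist_commute)
    then obtain j where j: "j < length ds" "dist (f x) (ds ! j) < \<delta>"
      using ds by (metis in_set_conv_nth)
    then have "idx x \<le> j"
      using that by (auto simp: idx_def intro!: Least_le)
    moreover have "dist (f x) (ds ! idx x) < \<delta> \<or> length ds \<le> idx x"
      using that j LeastI[of "\<lambda>j. dist (f x) (ds ! j) < \<delta> \<or> length ds \<le> j" j] by (simp add: idx_def)
    ultimately show ?thesis using j(1) by linarith
  qed
  have "(\<lambda>x. dist (f x) y) \<in> borel_measurable M" for y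
    by (rule measurable_compose[OF f_meas borel_measurable_continuous_onI]) (intro continuous_intros)
  then have [measurable]: "idx \<in> measurable M (count_space UNIV)"
    unfolding idx_def by measurable
  have "finite (range idx)"
    by (rule finite_subset[of _ "{..length ds}"]) (use idx_le in auto)
  then have "simple_function M idx"
    by (auto simp: simple_function_def intro!: measurable_sets[of idx M "count_space UNIV", simplified])
  then have sf: "simple_function M s"
    unfolding s_def by (rule simple_function_compose1)
  show ?thesis
  proof
    show "Bochner_Integration.simple_bochner_integrable M s"
      using sf by (auto intro!: Bochner_Integration.simple_bochner_integrable.intros)
    have "ds ! idx x \<in> range f" if "idx x < length ds" for x
      using that D(2) ds nth_mem by fastforce
    then show "range s \<subseteq> insert 0 (range f)"
      by (auto simp: s_def)
    have int': "integrable M (\<lambda>x. indicator (- K n) x * norm (f x))"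
      by (rule Bochner_Integration.integrable_bound[OF int])
        (use tail_meas in \<open>auto simp: indicator_def\<close>)
    have "norm (f x - s x) \<le> \<delta> + indicator (- K n) x * norm (f x)" for x
    proof (cases "x \<in> K n")
      case True
      then show ?thesis using idx_less[OF True] by (simp add: s_def dist_norm)
    next
      case False
      then show ?thesis using \<delta> by (simp add: s_def idx_def)
    qed
    then have "(\<integral>\<^sup>+x. ennreal (norm (f x - s x)) \<partial>M) \<le>
        (\<integral>\<^sup>+x. ennreal (\<delta> + indicator (- K n) x * norm (f x)) \<partial>M)"
      by (intro nn_integral_mono ennreal_leI)
    also have "\<dots> = ennreal (LINT x|M. \<delta> + indicator (- K n) x * norm (f x))"
      using \<delta> int' by (intro nn_integral_eq_integral) auto
    also have "(LINT x|M. \<delta> + indicator (- K n) x * norm (f x)) =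
        \<delta> * measure M UNIV + (LINT x|M. indicator (- K n) x * norm (f x))"
      using int' by (simp add: mult.commute)
    also have "\<dots> \<le> \<delta> * (measure M UNIV + 1) + e / 2"
      using \<delta> n by (intro add_mono mult_left_mono) auto
    also have "\<delta> * (measure M UNIV + 1) = e / 2"
      using nonzero_mult_divide_mult_cancel_right[of "measure M UNIV + 1" e 2]
        add_nonneg_pos[OF measure_nonneg[of M UNIV] zero_less_one]
      by (simp only: \<delta>_def times_divide_eq_left less_irrefl not_False_eq_True)
    also have "e / 2 + e / 2 = e" by simp
    finally show "(\<integral>\<^sup>+x. ennreal (norm (f x - s x)) \<partial>M) \<le> ennreal e"
      by (simp add: ennreal_leI order_trans)
  qed
qed

lemma norm_simple_integral_diff_le:
  fixes f :: "'a \<Rightarrow> 'h::real_normed_vector"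
  assumes f: "f \<in> borel_measurable M"
    and s: "Bochner_Integration.simple_bochner_integrable M s"
    and t: "Bochner_Integration.simple_bochner_integrable M t"
  shows "ennreal (norm (Bochner_Integration.simple_bochner_integral M s -
      Bochner_Integration.simple_bochner_integral M t)) \<le>
    (\<integral>\<^sup>+x. ennreal (norm (f x - s x)) \<partial>M) + (\<integral>\<^sup>+x. ennreal (norm (f x - t x)) \<partial>M)"
proof -
  have st: "Bochner_Integration.simple_bochner_integrable M (\<lambda>x. s x - t x)"
    and nst: "Bochner_Integration.simple_bochner_integrable M (\<lambda>x. norm (s x - t x))"
    using s t by (auto intro!: simple_bochner_integrable_compose2[where p = "\<lambda>x y. norm (x - y)"]
        simple_bochner_integrable_compose2[where p = "\<lambda>x y. x - y"])
  have "ennreal (norm (Bochner_Integration.simple_bochner_integral M s -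
      Bochner_Integration.simple_bochner_integral M t)) \<le>
      ennreal (Bochner_Integration.simple_bochner_integral M (\<lambda>x. norm (s x - t x)))"
    unfolding simple_bochner_integral_diff[OF s t, symmetric]
    by (rule ennreal_leI[OF simple_bochner_integral_norm_bound[OF st]])
  also have "\<dots> = (\<integral>\<^sup>+x. ennreal (norm (s x - t x)) \<partial>M)"
    using nst by (intro simple_bochner_integral_eq_nn_integral) auto
  also have "\<dots> \<le> (\<integral>\<^sup>+x. ennreal (norm (f x - s x)) + ennreal (norm (f x - t x)) \<partial>M)"
  proof (rule nn_integral_mono)
    fix x
    have "norm (s x - t x) \<le> norm (f x - s x) + norm (f x - t x)"
      using norm_triangle_ineq4[of "f x - t x" "f x - s x"] by simp
    then show "ennreal (norm (s x - t x)) \<le> ennreal (norm (f x - s x)) + ennreal (norm (f x - t x))"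
      by (simp add: ennreal_leI flip: ennreal_plus)
  qed
  also have "\<dots> = (\<integral>\<^sup>+x. ennreal (norm (f x - s x)) \<partial>M) + (\<integral>\<^sup>+x. ennreal (norm (f x - t x)) \<partial>M)"
    using borel_measurable_norm_diff_simple[OF f] s t
    by (intro nn_integral_add) (auto elim!: Bochner_Integration.simple_bochner_integrable.cases)
  finally show ?thesis .
qed

lemma vector_integral_in_closed_subspace:
  fixes f :: "'g::t2_space \<Rightarrow> 'h::{real_inner, banach}" and K :: "nat \<Rightarrow> 'g set"
  assumes M: "sets M = sets borel" and fin: "finite_measure M"
    and f: "continuous_on UNIV f"
    and K: "\<And>n. compact (K n)" "incseq K" "(\<Union>n. K n) = UNIV"
    and int: "integrable M (\<lambda>x. norm (f x))"
    and W: "subspace W" "closed W" "range f \<subseteq> W"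
  obtains m where "m \<in> W" "has_vector_integral M f m"
proof -
  have f_meas: "f \<in> borel_measurable M"
    using borel_measurable_continuous_onI[OF f] M by (simp cong: measurable_cong_sets)
  have "\<exists>s. Bochner_Integration.simple_bochner_integrable M s \<and> range s \<subseteq> insert 0 (range f) \<and>
      (\<integral>\<^sup>+x. ennreal (norm (f x - s x)) \<partial>M) \<le> ennreal (1 / Suc i)" for i
    by (rule simple_function_approximation[OF M fin f K int, where e = "1 / Suc i"])
      (simp, intro exI conjI)
  from choice[OF allI, OF this] obtain s
    where *: "\<forall>i. Bochner_Integration.simple_bochner_integrable M (s i) \<and>
      range (s i) \<subseteq> insert 0 (range f) \<and>
      (\<integral>\<^sup>+x. ennreal (norm (f x - s i x)) \<partial>M) \<le> ennreal (1 / Suc i)" ..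
  have s: "Bochner_Integration.simple_bochner_integrable M (s i)"
    and ran: "range (s i) \<subseteq> insert 0 (range f)"
    and approx: "(\<integral>\<^sup>+x. ennreal (norm (f x - s i x)) \<partial>M) \<le> ennreal (1 / Suc i)" for i
    by (rule spec[OF *, THEN conjunct1] spec[OF *, THEN conjunct2, THEN conjunct1]
        spec[OF *, THEN conjunct2, THEN conjunct2])+
  define I where "I i = Bochner_Integration.simple_bochner_integral M (s i)" for i
  have I_W: "I i \<in> W" for i
    unfolding I_def Bochner_Integration.simple_bochner_integral_def
  proof (intro subspace_sum subspace_scale W(1))
    show "y \<in> W" if "y \<in> s i ` space M" for y
    proof -
      have "insert 0 (range f) \<subseteq> W"
        using W(3) subspace_0[OF W(1)] by simp
      from order_trans[OF ran this] that show "y \<in> W" by (simp add: image_subset_iff) (elim imageE, simp)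
    qed
  qed
  have I_dist: "dist (I i) (I j) \<le> 1 / Suc i + 1 / Suc j" for i j
  proof -
    have "ennreal (norm (I i - I j)) \<le> ennreal (1 / Suc i) + ennreal (1 / Suc j)"
      unfolding I_def
      by (rule order_trans[OF norm_simple_integral_diff_le[OF f_meas s s] add_mono[OF approx approx]])
    then have "ennreal (norm (I i - I j)) \<le> ennreal (1 / Suc i + 1 / Suc j)"
      by (simp add: ennreal_plus)
    then show ?thesis
      by (subst (asm) ennreal_le_iff) (auto simp: dist_norm)
  qed
  have "Cauchy I"
  proof (rule metric_CauchyI)
    fix e :: real assume "e > 0"
    obtain N where N: "2 / Suc N < e"
      using reals_Archimedean[of "e / 2"] \<open>e > 0\<close> by (auto simp: field_simps)
    have "dist (I m) (I n) < e" if "m \<ge> N" "n \<ge> N" for m n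
    proof -
      have "1 / Suc m + 1 / Suc n \<le> 1 / Suc N + 1 / Suc N"
        using that by (intro add_mono divide_left_mono) auto
      with I_dist[of m n] N show ?thesis by linarith
    qed
    then show "\<exists>N. \<forall>m\<ge>N. \<forall>n\<ge>N. dist (I m) (I n) < e" by blast
  qed
  then obtain m where m: "I \<longlonglongrightarrow> m"
    by (auto simp: Cauchy_convergent_iff convergent_def)
  have lim: "(\<lambda>i. ennreal (1 / Suc i)) \<longlonglongrightarrow> 0"
    using tendsto_ennrealI[OF LIMSEQ_Suc[OF lim_1_over_n]] by simp
  show ?thesis
  proof
    show "m \<in> W"
      using closed_sequentially[OF W(2) I_W m] .
    have "(\<lambda>i. \<integral>\<^sup>+x. ennreal (norm (f x - s i x)) \<partial>M) \<longlonglongrightarrow> 0"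
      by (rule tendsto_sandwich[OF _ _ tendsto_const lim]) (use approx in \<open>auto intro!: always_eventually\<close>)
    then show "has_vector_integral M f m"
      using f_meas s m unfolding has_vector_integral_def I_def by blast
  qed
qed

section \<open>Compactly generated groups\<close>

lemma generates_induct:
  assumes "generates S" and "S \<subseteq> H" "0 \<in> H"
    and "\<And>x y. x \<in> H \<Longrightarrow> y \<in> H \<Longrightarrow> x + y \<in> H" and "\<And>x. x \<in> H \<Longrightarrow> - x \<in> H"
  shows "x \<in> H"
proof -
  have "(\<lambda>H. 0 \<in> H \<and> (\<forall>x\<in>H. \<forall>y\<in>H. x + y \<in> H) \<and> (\<forall>x\<in>H. - x \<in> H)) hull S \<subseteq> H"
    by (rule hull_minimal) (simp_all add: assms)
  with assms(1) show ?thesis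
    unfolding generates_def by (simp add: subset_UNIV subset_antisym top.extremum_unique)
qed

lemma set_power_Suc: "set_power Q (Suc n) = (\<lambda>(x, y). x + y) ` (Q \<times> set_power Q n)"
proof safe
  fix x assume "x \<in> set_power Q (Suc n)"
  then obtain qs where "x = sum_list qs" "length qs = Suc n" "set qs \<subseteq> Q"
    by (auto simp: set_power_def)
  moreover from this obtain q qs' where "qs = q # qs'"
    by (cases qs) auto
  ultimately show "x \<in> (\<lambda>(x, y). x + y) ` (Q \<times> set_power Q n)"
    by (force simp: set_power_def)
next
  fix q x assume "q \<in> Q" "x \<in> set_power Q n"
  then show "q + x \<in> set_power Q (Suc n)"
    by (force simp: set_power_def intro: exI[of _ "q # qs" for qs])
qed

lemma set_power_0: "set_power Q 0 = {0}"
  by (auto simp: set_power_def)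

lemma set_power_add:
  assumes "x \<in> set_power Q m" "y \<in> set_power Q n"
  shows "x + y \<in> set_power Q (m + n)"
proof -
  obtain qs rs where "x = sum_list qs" "length qs = m" "set qs \<subseteq> Q"
    "y = sum_list rs" "length rs = n" "set rs \<subseteq> Q"
    using assms by (auto simp: set_power_def)
  then show ?thesis
    by (auto simp: set_power_def intro!: exI[of _ "qs @ rs"])
qed

lemma set_power_uminus:
  assumes "uminus ` Q = Q"
  shows "x \<in> set_power Q n \<Longrightarrow> - x \<in> set_power Q n"
proof (induction n arbitrary: x)
  case 0
  then show ?case by (simp add: set_power_0)
next
  case (Suc n)
  then obtain q y where x: "x = q + y" "q \<in> Q" "y \<in> set_power Q n"
    by (auto simp: set_power_Suc)
  have "- q \<in> set_power Q 1"
    using x(2) assms by (force simp: set_power_Suc set_power_0)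
  from set_power_add[OF Suc.IH[OF x(3)] this] show ?case
    by (simp add: x(1) minus_add)
qed

lemma incseq_set_power:
  assumes "0 \<in> Q"
  shows "incseq (set_power Q)"
  using assms by (intro incseq_SucI) (force simp: set_power_Suc)

lemma compact_set_power:
  fixes Q :: "'g::{topological_group_add, t2_space} set"
  assumes "compact Q"
  shows "compact (set_power Q n)"
proof (induction n)
  case 0
  then show ?case by (simp add: set_power_0)
next
  case (Suc n)
  have "continuous_on (Q \<times> set_power Q n) (\<lambda>(x, y). x + y)"
    by (auto simp: case_prod_unfold intro!: continuous_intros)
  then show ?case
    using Suc assms by (simp add: set_power_Suc compact_continuous_image compact_Times)
qed

lemma Union_set_power:
  fixes Q :: "'g::{topological_group_add, t2_space} set"
  assumes "compact_generating_neighbourhood Q"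
  shows "(\<Union>n. set_power Q n) = UNIV"
proof -
  have Q: "generates Q" "uminus ` Q = Q"
    using assms by (auto simp: compact_generating_neighbourhood_def)
  have "x \<in> (\<Union>n. set_power Q n)" for x
  proof (rule generates_induct[OF Q(1)])
    show "Q \<subseteq> (\<Union>n. set_power Q n)"
      by (auto intro!: exI[of _ 1] simp: set_power_Suc set_power_0 image_iff)
    show "0 \<in> (\<Union>n. set_power Q n)"
      by (auto intro!: exI[of _ 0] simp: set_power_0)
    show "x + y \<in> (\<Union>n. set_power Q n)"
      if "x \<in> (\<Union>n. set_power Q n)" "y \<in> (\<Union>n. set_power Q n)" for x y
      using that set_power_add by blast
    show "- x \<in> (\<Union>n. set_power Q n)" if "x \<in> (\<Union>n. set_power Q n)" for x
      using that set_power_uminus[OF Q(2)] by blast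
  qed
  then show ?thesis by blast
qed

lemma open_translation:
  fixes V :: "'g::topological_group_add set"
  assumes "open V"
  shows "open ((\<lambda>y. x + y) ` V)"
proof -
  have "(\<lambda>y. x + y) ` V = (\<lambda>y. - x + y) -` V"
    by (auto simp: image_iff add.assoc[symmetric] intro!: bexI[of _ "- x + y" for y])
  moreover have "open ((\<lambda>y. - x + y) -` V)"
    by (intro open_vimage assms continuous_intros)
  ultimately show ?thesis by simp
qed

lemma borel_translation:
  fixes A :: "'g::topological_group_add set"
  assumes "A \<in> sets borel"
  shows "(\<lambda>y. x + y) ` A \<in> sets borel"
proof -
  have "(\<lambda>y. x + y) ` A = (\<lambda>y. - x + y) -` A"
    by (auto simp: image_iff add.assoc[symmetric] intro!: bexI[of _ "- x + y" for y])
  moreover have "(\<lambda>y. - x + y) \<in> borel_measurable borel"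
    by (intro borel_measurable_continuous_onI continuous_intros)
  ultimately show ?thesis
    using measurable_sets[of "\<lambda>y. - x + y" borel borel A] assms by simp
qed

text \<open>
  The density of \<open>\<mu>\<close> is bounded below on a compact set \<open>C\<close> of positive
  Haar measure, so a set \<open>E\<close> that is almost full for \<open>\<mu>\<close> contains most of \<open>C\<close>.  Regularity of Haar
  measure gives an open \<open>U' \<supseteq> C\<close> that is only slightly larger, and compactness gives \<open>V\<close> with
  \<open>V + C \<subseteq> U'\<close>.  For \<open>g \<in> V\<close> the sets \<open>C \<inter> E\<close> and \<open>g + (C \<inter> E)\<close> are then both too large to be disjoint
  in \<open>U'\<close>.  The point is that \<open>V\<close> does not depend on \<open>E\<close>.
\<close>

lemma steinhaus_absolutely_continuous:
  fixes \<mu> \<nu> :: "'g::{topological_group_add, t2_space} measure" and K :: "nat \<Rightarrow> 'g set"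
  assumes haar: "left_haar_measure \<nu>" and ac: "absolutely_continuous \<nu> \<mu>"
    and \<mu>: "sets \<mu> = sets borel" and prob: "prob_space \<mu>"
    and K: "\<And>n. compact (K n)" "(\<Union>n. K n) = UNIV"
  obtains \<epsilon> V where "\<epsilon> > 0" "open V" "0 \<in> V"
    "\<And>E g. E \<in> sets borel \<Longrightarrow> measure \<mu> (- E) < \<epsilon> \<Longrightarrow> g \<in> V \<Longrightarrow> \<exists>x\<in>E. \<exists>y\<in>E. g = x - y"
proof -
  interpret \<mu>: prob_space \<mu> by fact
  have \<nu>: "sets \<nu> = sets borel"
    and inv: "\<And>g A. A \<in> sets borel \<Longrightarrow> emeasure \<nu> ((\<lambda>x. g + x) ` A) = emeasure \<nu> A"
    and fin: "\<And>K. compact K \<Longrightarrow> emeasure \<nu> K < \<infinity>"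
    and reg: "\<And>A. A \<in> sets borel \<Longrightarrow> emeasure \<nu> A = (INF U\<in>{U. open U \<and> A \<subseteq> U}. emeasure \<nu> U)"
    using haar by (auto simp: left_haar_measure_def)
  have sp[simp]: "space \<nu> = UNIV" "space \<mu> = UNIV"
    using sets_eq_imp_space_eq[OF \<nu>] sets_eq_imp_space_eq[OF \<mu>] by auto
  have compact_sets: "C \<in> sets \<nu>" if "compact C" for C
    using that \<nu> by (simp add: compact_imp_closed)
  interpret \<nu>: sigma_finite_measure \<nu>
  proof
    show "\<exists>A. countable A \<and> A \<subseteq> sets \<nu> \<and> \<Union> A = space \<nu> \<and> (\<forall>a\<in>A. emeasure \<nu> a \<noteq> \<infinity>)"
      using K compact_sets fin by (intro exI[of _ "range K"]) (auto simp: less_top)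
  qed
  obtain f where f[measurable]: "f \<in> borel_measurable \<nu>" and dens: "density \<nu> f = \<mu>"
    using \<nu>.Radon_Nikodym[OF ac] \<mu> \<nu> by auto
  have em: "emeasure \<mu> A = (\<integral>\<^sup>+x\<in>A. f x \<partial>\<nu>)" if "A \<in> sets borel" for A
    using emeasure_density[OF f, of A] dens that \<nu> by simp
  define A where "A n m = {x \<in> K n. ennreal (1 / Suc m) < f x}" for n m
  have K_meas[measurable]: "K n \<in> sets \<nu>" for n
    using K compact_sets by blast
  have A_meas[measurable]: "A n m \<in> sets \<nu>" for n m
  proof -
    have "A n m = K n \<inter> {x \<in> space \<nu>. ennreal (1 / Suc m) < f x}"
      by (auto simp: A_def)
    also have "\<dots> \<in> sets \<nu>" by measurable
    finally show ?thesis .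
  qed
  have "\<exists>n m. emeasure \<nu> (A n m) \<noteq> 0"
  proof (rule ccontr)
    assume "\<not> ?thesis"
    then have "A n m \<in> null_sets \<nu>" for n m by auto
    then have "(\<Union>n. \<Union>m. A n m) \<in> null_sets \<nu>"
      by (intro null_sets_UN) auto
    moreover have "{x. f x \<noteq> 0} \<subseteq> (\<Union>n. \<Union>m. A n m)"
    proof
      fix x assume "x \<in> {x. f x \<noteq> 0}"
      then have "f x > 0" by (simp add: zero_less_iff_neq_zero)
      then obtain m where "ennreal (1 / Suc m) < f x"
      proof (cases "f x")
        case (real r)
        with \<open>f x > 0\<close> obtain m where "1 / Suc m < r"
          using reals_Archimedean[of r] by (auto simp: inverse_eq_divide)
        with real that show ?thesis by (auto simp: ennreal_less_iff)
      qed simp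
      moreover obtain n where "x \<in> K n" using K(2) by blast
      ultimately show "x \<in> (\<Union>n. \<Union>m. A n m)" by (auto simp: A_def)
    qed
    ultimately have "AE x in \<nu>. f x = 0"
      by (intro AE_I'[of "\<Union>n. \<Union>m. A n m"]) auto
    then have "(\<integral>\<^sup>+x. f x \<partial>\<nu>) = 0"
      by (simp add: nn_integral_0_iff_AE)
    then show False
      using em[of UNIV] \<mu>.emeasure_space_1 by simp
  qed
  then obtain n m where A: "emeasure \<nu> (A n m) \<noteq> 0" by blast
  have AK: "A n m \<subseteq> K n" by (auto simp: A_def)
  have "emeasure \<nu> (K n - A n m) < emeasure \<nu> (K n)"
  proof -
    have "emeasure \<nu> (K n) = emeasure \<nu> (A n m) + emeasure \<nu> (K n - A n m)"
      using AK plus_emeasure[of "A n m" \<nu> "K n - A n m"] by (simp add: Un_absorb1)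
    moreover have "emeasure \<nu> (K n - A n m) < top"
      using emeasure_mono[of "K n - A n m" "K n" \<nu>] fin[OF K(1), of n] by (auto intro: le_less_trans)
    ultimately show ?thesis
      using A by (metis add.commute add.right_neutral ennreal_add_left_cancel_less top.not_eq_extremum
          zero_less_iff_neq_zero infinity_ennreal_def)
  qed
  then obtain U where U: "open U" "K n - A n m \<subseteq> U" "emeasure \<nu> U < emeasure \<nu> (K n)"
    using reg[of "K n - A n m"] A_meas K_meas \<nu> by (auto simp: INF_less_iff)
  \<comment> \<open>A compact subset of \<open>A n m\<close> that is not null.\<close>
  define C where "C = K n - U"
  have C: "compact C" "C \<subseteq> A n m"
    using U K by (auto simp: C_def intro: compact_diff)
  have C_meas[measurable]: "C \<in> sets \<nu>" using C(1) by (rule compact_sets)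
  define c where "c = measure \<nu> C"
  have em_C: "emeasure \<nu> C = ennreal c"
    using fin[OF C(1)] by (simp add: c_def emeasure_eq_ennreal_measure)
  have "emeasure \<nu> C \<noteq> 0"
  proof
    assume "emeasure \<nu> C = 0"
    have "emeasure \<nu> (K n) \<le> emeasure \<nu> (C \<union> U)"
    proof (rule emeasure_mono)
      show "K n \<subseteq> C \<union> U" by (simp add: C_def)
      show "C \<union> U \<in> sets \<nu>" using C_meas U(1) \<nu> by (simp add: borel_open)
    qed
    also have "\<dots> \<le> emeasure \<nu> C + emeasure \<nu> U"
      using C_meas U(1) \<nu> by (intro emeasure_subadditive) (simp_all add: borel_open)
    finally show False
      using U(3) \<open>emeasure \<nu> C = 0\<close> by simp
  qed
  then have c: "c > 0"
    using em_C by (simp add: zero_less_measure_iff c_def)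
  have "emeasure \<nu> C < ennreal (3 / 2 * c)"
    unfolding em_C using c by (simp add: ennreal_less_iff)
  then obtain U' where U': "open U'" "C \<subseteq> U'" "emeasure \<nu> U' < ennreal (3 / 2 * c)"
    using reg[of C] C_meas \<nu> by (auto simp: INF_less_iff)
  have "open ((\<lambda>(g, x). g + x) -` U')"
    unfolding case_prod_unfold by (intro open_vimage U'(1) continuous_intros)
  moreover have "{0} \<times> C \<subseteq> (\<lambda>(g, x). g + x) -` U'"
    using U'(2) by auto
  ultimately have "\<exists>V. 0 \<in> V \<and> open V \<and> V \<times> C \<subseteq> (\<lambda>(g, x). g + x) -` U'"
    by (rule Elementary_Topology.tube_lemma[OF C(1)])
  then obtain V where V: "0 \<in> V" "open V" "V \<times> C \<subseteq> (\<lambda>(g, x). g + x) -` U'"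
    by (elim exE conjE)
  \<comment> \<open>On \<open>C\<close> the density is at least \<open>1 / Suc m\<close>, so a set with complement of \<open>\<mu>\<close>-measure below \<open>\<epsilon>\<close>
    misses less than a quarter of \<open>C\<close>.  Two sets larger than \<open>3 / 4 * c\<close> do not fit disjointly into \<open>U'\<close>.\<close>
  define \<epsilon> where "\<epsilon> = 1 / Suc m * (c / 4)"
  show ?thesis
  proof
    show "\<epsilon> > 0" "open V" "0 \<in> V" using V c by (auto simp: \<epsilon>_def)
    fix E g assume E: "E \<in> sets borel" "measure \<mu> (- E) < \<epsilon>" and g: "g \<in> V"
    have E_meas[measurable]: "E \<in> sets \<nu>" using E(1) \<nu> by simp
    define N C' where "N = C - E" and "C' = C \<inter> E"
    have NC_meas[measurable]: "N \<in> sets \<nu>" "C' \<in> sets \<nu>" by (auto simp: N_def C'_def)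
    have fin': "emeasure \<nu> N \<noteq> \<infinity>" "emeasure \<nu> C' \<noteq> \<infinity>"
      using emeasure_mono[of N C \<nu>] emeasure_mono[of C' C \<nu>] em_C
      by (auto simp: N_def C'_def top_unique)
    have "ennreal (1 / Suc m) * emeasure \<nu> N = (\<integral>\<^sup>+x\<in>N. ennreal (1 / Suc m) \<partial>\<nu>)"
      by (simp add: nn_integral_cmult_indicator)
    also have "\<dots> \<le> (\<integral>\<^sup>+x\<in>N. f x \<partial>\<nu>)"
      using C(2) by (intro nn_integral_mono) (auto simp: N_def A_def indicator_def)
    also have "\<dots> = emeasure \<mu> N"
      using NC_meas \<nu> by (simp add: em)
    also have "\<dots> \<le> emeasure \<mu> (- E)"
      using E(1) \<mu> by (intro emeasure_mono) (auto simp: N_def)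
    also have "\<dots> < ennreal \<epsilon>"
      using E(2) by (simp add: \<mu>.emeasure_eq_measure ennreal_less_iff)
    finally have "ennreal (1 / Suc m * measure \<nu> N) < ennreal \<epsilon>"
      using fin'(1) by (simp add: emeasure_eq_ennreal_measure flip: ennreal_mult del: times_divide_eq_left)
    then have N: "measure \<nu> N < c / 4"
      unfolding \<epsilon>_def
      by (subst (asm) ennreal_less_iff) (simp_all add: divide_less_cancel del: times_divide_eq_left)
    have "emeasure \<nu> C = emeasure \<nu> N + emeasure \<nu> C'"
    proof -
      have "N \<union> C' = C" "N \<inter> C' = {}" by (auto simp: N_def C'_def)
      then show ?thesis using plus_emeasure[OF NC_meas] by simp
    qed
    then have "c = measure \<nu> N + measure \<nu> C'"
      using fin' by (simp add: em_C emeasure_eq_ennreal_measure c_def flip: ennreal_plus)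
    with N have C': "measure \<nu> C' > 3 / 4 * c" by simp
    define D where "D = (\<lambda>x. g + x) ` C'"
    have D_meas: "D \<in> sets \<nu>"
      unfolding D_def using NC_meas(2) \<nu> by (simp add: borel_translation)
    have "D \<inter> C' \<noteq> {}"
    proof
      assume "D \<inter> C' = {}"
      then have "emeasure \<nu> (D \<union> C') = emeasure \<nu> D + emeasure \<nu> C'"
        using D_meas NC_meas by (simp add: plus_emeasure)
      also have "\<dots> = ennreal (measure \<nu> C' + measure \<nu> C')"
        using inv[of C' g] NC_meas \<nu> fin'
        by (simp add: D_def emeasure_eq_ennreal_measure del: mult_2 flip: ennreal_plus)
      finally have "ennreal (measure \<nu> C' + measure \<nu> C') = emeasure \<nu> (D \<union> C')" by simp
      also have "\<dots> \<le> emeasure \<nu> U'"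
        using U' V(3) g \<nu> by (intro emeasure_mono) (auto simp: D_def C'_def)
      also have "\<dots> < ennreal (3 / 2 * c)" by (rule U')
      finally show False
        using C' c by (simp add: ennreal_less_iff)
    qed
    then obtain y where "y \<in> C'" "g + y \<in> C'" by (auto simp: D_def)
    moreover have "g = (g + y) - y" by simp
    ultimately show "\<exists>x\<in>E. \<exists>y\<in>E. g = x - y"
      unfolding C'_def by blast
  qed
qed

section \<open>Cocycles\<close>

context unitary_representation
begin

lemma rep_add_vec: "\<pi> g (x + y) = \<pi> g x + \<pi> g y"
  using rep_linear[of g] by (simp add: Vector_Spaces.linear_def module_hom_def module_hom_axioms_def)

lemma rep_smul: "\<pi> g (smul c x) = smul c (\<pi> g x)"
  using rep_linear[of g] by (simp add: Vector_Spaces.linear_def module_hom_def module_hom_axioms_def)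

lemma rep_inner: "\<pi> g x \<bullet> \<pi> g y = x \<bullet> y"
proof -
  have "(of_real (2 * (\<pi> g x \<bullet> \<pi> g y)) :: 'k) = of_real (2 * (x \<bullet> y))"
    unfolding of_real_inner by (simp add: rep_ip)
  then show ?thesis
    unfolding of_real_eq_iff by simp
qed

lemma rep_norm: "norm (\<pi> g x) = norm x"
  by (simp add: norm_eq_sqrt_inner rep_inner)

lemma bounded_linear_rep: "bounded_linear (\<pi> g)"
proof (rule bounded_linear_intro[where K = 1])
  show "\<pi> g (r *\<^sub>R x) = r *\<^sub>R \<pi> g x" for r x
    using rep_smul[of g "of_real r" x] by (simp add: scale_of_real)
qed (simp_all add: rep_add_vec rep_norm)

lemmas rep_diff_vec = bounded_linear.linear[OF bounded_linear_rep, THEN linear_diff]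

lemma rep_minus_inverse: "\<pi> (- g) (\<pi> g x) = x"
  using rep_add[of "- g" g] by (simp add: rep_zero fun_eq_iff)

lemma rep_inner_left: "\<pi> g x \<bullet> y = x \<bullet> \<pi> (- g) y"
  using rep_inner[of "- g" "\<pi> g x" y] by (simp add: rep_minus_inverse)

lemma cocycle_continuous: "c \<in> cocycles \<pi> \<Longrightarrow> continuous_on UNIV c"
  and cocycle_add_group: "c \<in> cocycles \<pi> \<Longrightarrow> c (g + h) = c g + \<pi> g (c h)"
  by (simp_all add: cocycles_def)

lemma cocycle_zero: "c \<in> cocycles \<pi> \<Longrightarrow> c 0 = 0"
  using cocycle_add_group[of c 0 0] by (simp add: rep_zero)

lemma cocycle_minus: "c \<in> cocycles \<pi> \<Longrightarrow> c (- g) = - \<pi> (- g) (c g)"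
  using cocycle_add_group[of c "- g" g] by (simp add: cocycle_zero eq_neg_iff_add_eq_0)

lemma norm_cocycle_add: "c \<in> cocycles \<pi> \<Longrightarrow> norm (c (g + h)) \<le> norm (c g) + norm (c h)"
  using norm_triangle_ineq[of "c g" "\<pi> g (c h)"] by (simp add: cocycle_add_group rep_norm)

lemma norm_cocycle_minus: "c \<in> cocycles \<pi> \<Longrightarrow> norm (c (- g)) = norm (c g)"
  by (simp add: cocycle_minus rep_norm)

lemma norm_cocycle_diff: "c \<in> cocycles \<pi> \<Longrightarrow> norm (c (g - h)) \<le> norm (c g) + norm (c h)"
  using norm_cocycle_add[of c g "- h"] by (simp add: norm_cocycle_minus)

lemma cocycles_add: "c \<in> cocycles \<pi> \<Longrightarrow> d \<in> cocycles \<pi> \<Longrightarrow> (\<lambda>x. c x + d x) \<in> cocycles \<pi>"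
  by (auto simp: cocycles_def rep_add_vec intro!: continuous_intros)

lemma cocycles_diff: "c \<in> cocycles \<pi> \<Longrightarrow> d \<in> cocycles \<pi> \<Longrightarrow> (\<lambda>x. c x - d x) \<in> cocycles \<pi>"
  by (auto simp: cocycles_def rep_diff_vec intro!: continuous_intros)

lemma cocycles_smul: "c \<in> cocycles \<pi> \<Longrightarrow> (\<lambda>x. smul a (c x)) \<in> cocycles \<pi>"
  by (auto simp: cocycles_def rep_smul scale_right_distrib
      intro!: bounded_linear.continuous_on[OF bounded_linear_smul])

lemma cocycles_coboundary: "coboundary \<pi> v \<in> cocycles \<pi>"
  using rep_strongly_continuous
  by (auto simp: cocycles_def coboundary_def rep_add rep_diff_vec intro!: continuous_intros)

lemma coboundary_add: "coboundary \<pi> (v + w) x = coboundary \<pi> v x + coboundary \<pi> w x"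
  and coboundary_diff: "coboundary \<pi> (v - w) x = coboundary \<pi> v x - coboundary \<pi> w x"
  and coboundary_scaleR: "coboundary \<pi> (r *\<^sub>R v) x = r *\<^sub>R coboundary \<pi> v x"
  by (simp_all add: coboundary_def rep_add_vec rep_diff_vec scaleR_diff_right
      linear_scale[OF bounded_linear.linear[OF bounded_linear_rep]])

lemma norm_cocycle_set_power:
  assumes c: "c \<in> cocycles \<pi>" and M: "\<And>q. q \<in> Q \<Longrightarrow> norm (c q) \<le> M"
  shows "x \<in> set_power Q n \<Longrightarrow> norm (c x) \<le> n * M"
proof (induction n arbitrary: x)
  case 0
  then show ?case by (simp add: set_power_0 cocycle_zero[OF c])
next
  case (Suc n)
  then obtain q y where x: "x = q + y" "q \<in> Q" "y \<in> set_power Q n"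
    by (auto simp: set_power_Suc)
  have "norm (c x) \<le> M + n * M"
    unfolding x(1)
    by (rule order_trans[OF norm_cocycle_add[OF c] add_mono[OF M[OF x(2)] Suc.IH[OF x(3)]]])
  then show ?case by (simp add: algebra_simps)
qed

text \<open>Continuity passes to the limit because each point \<open>x\<close> has the compact neighbourhood \<open>x + Q\<close>.\<close>

lemma cocycles_uniform_limit:
  fixes Q :: "'g set"
  assumes Q: "compact Q" "0 \<in> interior Q"
    and c: "\<And>n. c n \<in> cocycles \<pi>"
    and lim: "\<And>K. compact K \<Longrightarrow> uniform_limit K c z sequentially"
  shows "z \<in> cocycles \<pi>"
proof -
  have pt: "(\<lambda>n. c n x) \<longlonglongrightarrow> z x" for x
    using lim[of "{x}"] by (rule tendsto_uniform_limitI) auto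
  have "z (g + h) = z g + \<pi> g (z h)" for g h
  proof (rule LIMSEQ_unique[OF pt])
    show "(\<lambda>n. c n (g + h)) \<longlonglongrightarrow> z g + \<pi> g (z h)"
      unfolding cocycle_add_group[OF c]
      by (intro tendsto_add pt bounded_linear.tendsto[OF bounded_linear_rep])
  qed
  moreover have "isCont z x" for x
  proof -
    have "compact ((\<lambda>y. x + y) ` Q)"
      using Q(1) by (intro compact_continuous_image continuous_intros)
    from uniform_limit_theorem[OF _ lim[OF this]]
    have "continuous_on ((\<lambda>y. x + y) ` Q) z"
      using continuous_on_subset[OF cocycle_continuous[OF c] subset_UNIV] by simp
    then have "continuous_on ((\<lambda>y. x + y) ` interior Q) z"
      by (rule continuous_on_subset) (intro image_mono interior_subset)
    moreover have "x \<in> (\<lambda>y. x + y) ` interior Q"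
      using Q(2) by force
    ultimately show "isCont z x"
      using continuous_on_eq_continuous_at[OF open_translation[OF open_interior]] by blast
  qed
  ultimately show ?thesis
    by (simp add: cocycles_def continuous_on_eq_continuous_at)
qed

end

section \<open>Square-integrable cocycles\<close>

locale adapted_representation = unitary_representation smul ip \<pi>
  for smul :: "'k::real_or_complex \<Rightarrow> 'h::{real_inner, banach} \<Rightarrow> 'h"
    and ip :: "'h \<Rightarrow> 'h \<Rightarrow> 'k"
    and \<pi> :: "'g::{topological_group_add, t2_space} \<Rightarrow> 'h \<Rightarrow> 'h" +
  fixes Q :: "'g set" and \<mu> :: "'g measure"
  assumes generating: "compact_generating_neighbourhood Q"
    and adapted: "cohomologically_adapted Q \<mu>"
begin

lemma compact_Q: "compact Q" and zero_interior_Q: "0 \<in> interior Q" and zero_in_Q: "0 \<in> Q"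
  using generating interior_subset[of Q] by (auto simp: compact_generating_neighbourhood_def)

lemma sets_mu: "sets \<mu> = sets borel" and prob_mu: "prob_space \<mu>"
  using adapted by (auto simp: cohomologically_adapted_def)

sublocale mu: prob_space \<mu> by (rule prob_mu)

lemma space_mu: "space \<mu> = UNIV"
  using sets_eq_imp_space_eq[OF sets_mu] by simp

lemma continuous_measurable: "continuous_on UNIV f \<Longrightarrow> f \<in> borel_measurable \<mu>"
  using borel_measurable_continuous_onI[of f] sets_mu by (simp cong: measurable_cong_sets)

definition second_moment :: real where
  "second_moment = enn2real (\<integral>\<^sup>+x. of_nat ((word_length Q x)\<^sup>2) \<partial>\<mu>)"

definition energy :: "('g \<Rightarrow> 'h) \<Rightarrow> real" where
  "energy c = (LINT x|\<mu>. (norm (c x))\<^sup>2)"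

lemma set_power_word_length: "x \<in> set_power Q (word_length Q x)"
proof -
  have "x \<in> (\<Union>n. set_power Q n)"
    by (simp add: Union_set_power[OF generating])
  then show ?thesis
    unfolding word_length_def by (auto intro: LeastI)
qed

lemma cocycle_bounded_on_compact:
  assumes "c \<in> cocycles \<pi>" "compact K"
  obtains M where "M > 0" "\<And>q. q \<in> K \<Longrightarrow> norm (c q) \<le> M"
proof -
  have "compact (c ` K)"
    using assms cocycle_continuous by (intro compact_continuous_image) (auto intro: continuous_on_subset)
  then show ?thesis
    using that bounded_pos[of "c ` K"] by (auto dest!: compact_imp_bounded)
qed

text \<open>
  This is where the finite second moment is used: cocycles grow at most linearly in the word length.
\<close>

lemma nn_energy_le:
  assumes c: "c \<in> cocycles \<pi>" and M: "M > 0" "\<And>q. q \<in> Q \<Longrightarrow> norm (c q) \<le> M"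
  shows "(\<integral>\<^sup>+x. ennreal ((norm (c x))\<^sup>2) \<partial>\<mu>) \<le> ennreal (M\<^sup>2 * second_moment)"
proof -
  have meas: "(\<lambda>x. (norm (c x) / M)\<^sup>2) \<in> borel_measurable \<mu>"
    using cocycle_continuous[OF c] M(1) by (intro continuous_measurable continuous_intros) auto
  have "(norm (c x) / M)\<^sup>2 \<le> (word_length Q x)\<^sup>2" for x
  proof -
    have "norm (c x) \<le> word_length Q x * M"
      by (rule norm_cocycle_set_power[OF c M(2) set_power_word_length])
    then have "(norm (c x) / M)\<^sup>2 \<le> (real (word_length Q x))\<^sup>2"
      using M(1) by (intro power_mono) (simp_all add: divide_le_eq)
    then show ?thesis by simp
  qed
  then have "(\<integral>\<^sup>+x. ennreal ((norm (c x) / M)\<^sup>2) \<partial>\<mu>) \<le> (\<integral>\<^sup>+x. of_nat ((word_length Q x)\<^sup>2) \<partial>\<mu>)"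
    by (intro nn_integral_mono) (simp add: ennreal_leI ennreal_of_nat_eq_real_of_nat)
  also have "\<dots> = ennreal second_moment"
    using adapted by (simp add: second_moment_def cohomologically_adapted_def)
  finally have "ennreal (M\<^sup>2) * (\<integral>\<^sup>+x. ennreal ((norm (c x) / M)\<^sup>2) \<partial>\<mu>) \<le> ennreal (M\<^sup>2) * ennreal second_moment"
    by (rule mult_left_mono) simp
  also have "ennreal (M\<^sup>2) * (\<integral>\<^sup>+x. ennreal ((norm (c x) / M)\<^sup>2) \<partial>\<mu>) =
      (\<integral>\<^sup>+x. ennreal (M\<^sup>2) * ennreal ((norm (c x) / M)\<^sup>2) \<partial>\<mu>)"
    using meas by (intro nn_integral_cmult[symmetric]) simp
  also have "\<dots> = (\<integral>\<^sup>+x. ennreal ((norm (c x))\<^sup>2) \<partial>\<mu>)"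
    using M(1) by (intro nn_integral_cong) (simp add: ennreal_mult[symmetric] power_divide)
  finally show ?thesis
    by (simp add: ennreal_mult second_moment_def)
qed

lemma cocycle_square_integrable:
  assumes c: "c \<in> cocycles \<pi>"
  shows "integrable \<mu> (\<lambda>x. (norm (c x))\<^sup>2)"
proof -
  obtain M where "M > 0" "\<And>q. q \<in> Q \<Longrightarrow> norm (c q) \<le> M"
    using cocycle_bounded_on_compact[OF c compact_Q] by metis
  from nn_energy_le[OF c this] show ?thesis
    using cocycle_continuous[OF c]
    by (intro integrableI_bounded continuous_measurable continuous_intros)
      (auto intro: le_less_trans)
qed

lemma energy_nonneg: "energy c \<ge> 0"
  by (simp add: energy_def)

lemma energy_le:
  assumes c: "c \<in> cocycles \<pi>" and M: "M > 0" "\<And>q. q \<in> Q \<Longrightarrow> norm (c q) \<le> M"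
  shows "energy c \<le> M\<^sup>2 * second_moment"
proof -
  have "ennreal (energy c) \<le> ennreal (M\<^sup>2 * second_moment)"
    using nn_energy_le[OF c M] nn_integral_eq_integral[OF cocycle_square_integrable[OF c]]
    by (simp add: energy_def)
  then show ?thesis
    by (subst (asm) ennreal_le_iff) (auto simp: second_moment_def)
qed

lemma cocycle_norm_integrable:
  assumes c: "c \<in> cocycles \<pi>"
  shows "integrable \<mu> (\<lambda>x. norm (c x))"
proof (rule Bochner_Integration.integrable_bound[where f = "\<lambda>x. 1 + (norm (c x))\<^sup>2"])
  show "integrable \<mu> (\<lambda>x. 1 + (norm (c x))\<^sup>2)"
    using cocycle_square_integrable[OF c] by simp
  show "(\<lambda>x. norm (c x)) \<in> borel_measurable \<mu>"
    using cocycle_continuous[OF c] by (intro continuous_measurable continuous_intros)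
  have "norm (c x) \<le> 1 + (norm (c x))\<^sup>2" for x
    using sum_squares_bound[of 1 "norm (c x)"] norm_ge_zero[of "c x"] unfolding one_power2 by linarith
  then show "AE x in \<mu>. norm (norm (c x)) \<le> norm (1 + (norm (c x))\<^sup>2)"
    by (auto intro: order_trans)
qed

lemma integrable_bilinear_cocycles:
  fixes p :: "'h \<Rightarrow> 'h \<Rightarrow> 'b::{banach, second_countable_topology}"
  assumes p: "bounded_bilinear p" "\<And>x y. norm (p x y) \<le> norm x * norm y"
    and c: "c \<in> cocycles \<pi>" and d: "d \<in> cocycles \<pi>"
  shows "integrable \<mu> (\<lambda>x. p (c x) (d x))"
proof (rule Bochner_Integration.integrable_bound[where f = "\<lambda>x. (norm (c x))\<^sup>2 + (norm (d x))\<^sup>2"])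
  show "integrable \<mu> (\<lambda>x. (norm (c x))\<^sup>2 + (norm (d x))\<^sup>2)"
    using cocycle_square_integrable c d by simp
  show "(\<lambda>x. p (c x) (d x)) \<in> borel_measurable \<mu>"
    using cocycle_continuous c d
    by (intro continuous_measurable bounded_bilinear.continuous_on[OF p(1)]) auto
  have "norm (p (c x) (d x)) \<le> (norm (c x))\<^sup>2 + (norm (d x))\<^sup>2" for x
    using p(2)[of "c x" "d x"] sum_squares_bound[of "norm (c x)" "norm (d x)"]
      mult_nonneg_nonneg[OF norm_ge_zero norm_ge_zero, of "c x" "d x"] by linarith
  then show "AE x in \<mu>. norm (p (c x) (d x)) \<le> norm ((norm (c x))\<^sup>2 + (norm (d x))\<^sup>2)"
    by simp
qed

lemmas integrable_inner_cocycles =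
  integrable_bilinear_cocycles[OF bounded_bilinear_inner Cauchy_Schwarz_ineq2[folded real_norm_def]]
lemmas integrable_ip_cocycles = integrable_bilinear_cocycles[OF bounded_bilinear_ip norm_ip_le]

lemma integrable_inner_const:
  assumes c: "c \<in> cocycles \<pi>"
  shows "integrable \<mu> (\<lambda>x. c x \<bullet> v)"
proof (rule Bochner_Integration.integrable_bound[where f = "\<lambda>x. norm (c x) * norm v"])
  show "integrable \<mu> (\<lambda>x. norm (c x) * norm v)"
    using cocycle_norm_integrable[OF c] by simp
  show "(\<lambda>x. c x \<bullet> v) \<in> borel_measurable \<mu>"
    using cocycle_continuous[OF c] by (intro continuous_measurable continuous_intros)
  show "AE x in \<mu>. norm (c x \<bullet> v) \<le> norm (norm (c x) * norm v)"
    by (simp add: Cauchy_Schwarz_ineq2)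
qed

lemma energy_inner: "energy c = (LINT x|\<mu>. c x \<bullet> c x)"
  by (simp add: energy_def power2_norm_eq_inner)

lemma energy_add:
  assumes "c \<in> cocycles \<pi>" "d \<in> cocycles \<pi>"
  shows "energy (\<lambda>x. c x + d x) = energy c + 2 * (LINT x|\<mu>. c x \<bullet> d x) + energy d"
  using assms unfolding energy_inner
  by (simp add: inner_add_left inner_add_right inner_commute integrable_inner_cocycles
      Bochner_Integration.integrable_add)

text \<open>
  The inequality of the means is weighted by \<open>M\<close> so that both terms on the right tend to zero with \<open>M\<close>.
\<close>

lemma abs_integral_inner_le:
  assumes c: "c \<in> cocycles \<pi>" and d: "d \<in> cocycles \<pi>"
    and M: "M > 0" "\<And>q. q \<in> Q \<Longrightarrow> norm (c q) \<le> M"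
  shows "\<bar>LINT x|\<mu>. c x \<bullet> d x\<bar> \<le> M * (second_moment + energy d)"
proof -
  have "\<bar>c x \<bullet> d x\<bar> \<le> (norm (c x))\<^sup>2 / M + M * (norm (d x))\<^sup>2" for x
  proof -
    have *: "(norm (c x) / sqrt M) * (norm (d x) * sqrt M) = norm (c x) * norm (d x)"
      using M(1) by simp
    have "2 * (norm (c x) * norm (d x)) \<le> (norm (c x) / sqrt M)\<^sup>2 + (norm (d x) * sqrt M)\<^sup>2"
      using sum_squares_bound[of "norm (c x) / sqrt M" "norm (d x) * sqrt M"]
      unfolding mult.assoc * .
    also have "\<dots> = (norm (c x))\<^sup>2 / M + M * (norm (d x))\<^sup>2"
      using M(1) by (simp add: power_mult_distrib power_divide)
    finally have "2 * (norm (c x) * norm (d x)) \<le> (norm (c x))\<^sup>2 / M + M * (norm (d x))\<^sup>2" .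
    then show ?thesis
      using Cauchy_Schwarz_ineq2[of "c x" "d x"] mult_nonneg_nonneg[OF norm_ge_zero norm_ge_zero, of "c x" "d x"]
      by linarith
  qed
  then have "(LINT x|\<mu>. \<bar>c x \<bullet> d x\<bar>) \<le> (LINT x|\<mu>. (norm (c x))\<^sup>2 / M + M * (norm (d x))\<^sup>2)"
    using cocycle_square_integrable c d
    by (intro integral_mono integrable_abs integrable_inner_cocycles) auto
  also have "\<dots> = energy c / M + M * energy d"
    using cocycle_square_integrable c d by (simp add: energy_def)
  also have "energy c / M \<le> M * second_moment"
    using energy_le[OF c M] M(1) by (simp add: divide_le_eq power2_eq_square mult_ac)
  finally show ?thesis
    using integral_abs_bound[of \<mu> "\<lambda>x. c x \<bullet> d x"] unfolding distrib_left by linarith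
qed

lemma integral_inner_uniform_limit:
  assumes c: "\<And>n. c n \<in> cocycles \<pi>" and z: "z \<in> cocycles \<pi>" and d: "d \<in> cocycles \<pi>"
    and lim: "uniform_limit Q c z sequentially"
  shows "(\<lambda>n. LINT x|\<mu>. c n x \<bullet> d x) \<longlonglongrightarrow> (LINT x|\<mu>. z x \<bullet> d x)"
proof (rule tendstoI)
  fix e :: real assume e: "e > 0"
  define D where "D = second_moment + energy d + 1"
  have D: "D > 0"
    using energy_nonneg[of d] by (simp add: D_def second_moment_def add_nonneg_pos)
  have "\<forall>\<^sub>F n in sequentially. \<forall>q\<in>Q. dist (c n q) (z q) < e / D"
    using lim e D by (simp add: uniform_limit_iff)
  then show "\<forall>\<^sub>F n in sequentially. dist (LINT x|\<mu>. c n x \<bullet> d x) (LINT x|\<mu>. z x \<bullet> d x) < e"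
  proof eventually_elim
    case (elim n)
    have "\<bar>LINT x|\<mu>. (c n x - z x) \<bullet> d x\<bar> \<le> e / D * (second_moment + energy d)"
      using elim e D by (intro abs_integral_inner_le cocycles_diff c z d) (auto simp: dist_norm less_imp_le)
    also have "\<dots> < e / D * D"
      using e D by (intro mult_strict_left_mono) (auto simp: D_def)
    also have "\<dots> = e" using D by simp
    also have "(LINT x|\<mu>. (c n x - z x) \<bullet> d x) = (LINT x|\<mu>. c n x \<bullet> d x) - (LINT x|\<mu>. z x \<bullet> d x)"
      using integrable_inner_cocycles c z d by (simp add: inner_diff_left)
    finally show ?case by (simp add: dist_real_def)
  qed
qed

end

section \<open>Comparison of the square norm with uniform convergence on compact sets\<close>

context adapted_representation
begin

lemma markov_energy:
  assumes c: "c \<in> cocycles \<pi>" and s: "s > 0" "energy c < s\<^sup>2" and p: "p > 0"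
  shows "{x. norm (c x) \<le> s / sqrt p} \<in> sets borel"
    and "measure \<mu> (- {x. norm (c x) \<le> s / sqrt p}) < p"
proof -
  define E where "E = {x. norm (c x) \<le> s / sqrt p}"
  have "closed E"
    unfolding E_def using cocycle_continuous[OF c] by (intro closed_Collect_le continuous_intros)
  then show "{x. norm (c x) \<le> s / sqrt p} \<in> sets borel"
    by (simp add: E_def)
  have E_meas: "- E \<in> sets \<mu>"
    using \<open>closed E\<close> sets_mu by (simp add: borel_open open_Compl)
  have pos: "s\<^sup>2 / p > 0" using s p by simp
  have "s\<^sup>2 / p * indicator (- E) x \<le> (norm (c x))\<^sup>2" for x
  proof (cases "x \<in> E")
    case False
    then have "(s / sqrt p)\<^sup>2 \<le> (norm (c x))\<^sup>2"
      using s p by (intro power_mono) (auto simp: E_def)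
    with False p show ?thesis by (simp add: power_divide)
  qed simp
  then have "(LINT x|\<mu>. s\<^sup>2 / p * indicator (- E) x) \<le> energy c"
    unfolding energy_def using cocycle_square_integrable[OF c] E_meas
    by (intro integral_mono integrable_mult_right integrable_real_indicator)
      (auto simp: less_top[symmetric] mu.emeasure_eq_measure)
  then have "s\<^sup>2 / p * measure \<mu> (- E) < s\<^sup>2"
    using s(2) by (simp add: space_mu)
  then have "measure \<mu> (- E) < p"
    using p s(1) by (simp add: divide_less_eq mult.commute)
  then show "measure \<mu> (- {x. norm (c x) \<le> s / sqrt p}) < p"
    by (simp add: E_def)
qed

text \<open>
  The set on which \<open>norm (c x) \<le> s / sqrt \<epsilon>\<close> is almost full by Chebyshev's inequality, so every point
  of \<open>V\<close> is a difference of two of its points.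
\<close>

lemma bounded_near_zero:
  obtains V C where "open V" "0 \<in> V" "C \<ge> 0"
    "\<And>c s x. c \<in> cocycles \<pi> \<Longrightarrow> s > 0 \<Longrightarrow> energy c < s\<^sup>2 \<Longrightarrow> x \<in> V \<Longrightarrow> norm (c x) \<le> C * s"
proof -
  obtain \<nu> where \<nu>: "left_haar_measure \<nu>" "absolutely_continuous \<nu> \<mu>"
    using adapted by (auto simp: cohomologically_adapted_def)
  obtain \<epsilon> V where V: "\<epsilon> > 0" "open V" "0 \<in> V"
    and St: "\<And>E g. E \<in> sets borel \<Longrightarrow> measure \<mu> (- E) < \<epsilon> \<Longrightarrow> g \<in> V \<Longrightarrow> \<exists>x\<in>E. \<exists>y\<in>E. g = x - y"
    by (rule steinhaus_absolutely_continuous[OF \<nu> sets_mu prob_mu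
          compact_set_power[OF compact_Q] Union_set_power[OF generating]]) blast
  show ?thesis
  proof
    show "open V" "0 \<in> V" "2 / sqrt \<epsilon> \<ge> 0" using V by auto
    fix c s x assume c: "c \<in> cocycles \<pi>" and s: "s > 0" "energy c < s\<^sup>2" and x: "x \<in> V"
    obtain y z where yz: "norm (c y) \<le> s / sqrt \<epsilon>" "norm (c z) \<le> s / sqrt \<epsilon>" "x = y - z"
      using St[OF markov_energy[OF c s V(1)] x] by auto
    show "norm (c x) \<le> 2 / sqrt \<epsilon> * s"
      using norm_cocycle_diff[OF c, of y z] yz by simp
  qed
qed

text \<open>
  At a point \<open>x\<close> of the support the bound follows from the one near \<open>0\<close>, because Chebyshev's
  inequality provides a point of the neighbourhood \<open>x + V\<close> at which \<open>c\<close> is not large.  The points that admit a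
  bound form a subgroup.
\<close>

lemma bounded_at_point:
  obtains C where "C \<ge> 0"
    "\<And>c s. c \<in> cocycles \<pi> \<Longrightarrow> s > 0 \<Longrightarrow> energy c < s\<^sup>2 \<Longrightarrow> norm (c x) \<le> C * s"
proof -
  obtain V C0 where V: "open V" "0 \<in> V" and C0: "C0 \<ge> 0"
    "\<And>c s x. c \<in> cocycles \<pi> \<Longrightarrow> s > 0 \<Longrightarrow> energy c < s\<^sup>2 \<Longrightarrow> x \<in> V \<Longrightarrow> norm (c x) \<le> C0 * s"
    using bounded_near_zero by metis
  define H where "H = {x. \<exists>C\<ge>0. \<forall>c\<in>cocycles \<pi>. \<forall>s>0. energy c < s\<^sup>2 \<longrightarrow> norm (c x) \<le> C * s}"
  have gen: "generates (measure_support \<mu>)"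
    using adapted by (simp add: cohomologically_adapted_def)
  have "x \<in> H"
  proof (rule generates_induct[OF gen])
    show "measure_support \<mu> \<subseteq> H"
    proof
      fix x assume x: "x \<in> measure_support \<mu>"
      define U where "U = (\<lambda>v. x + v) ` V"
      have U: "open U" "x \<in> U"
        unfolding U_def using open_translation[OF V(1)] V(2) by force+
      define p where "p = measure \<mu> U"
      have p: "p > 0"
        using x U by (auto simp: measure_support_def p_def mu.emeasure_eq_measure zero_less_measure_iff)
      have "norm (c x) \<le> (1 / sqrt p + C0) * s"
        if c: "c \<in> cocycles \<pi>" and s: "s > 0" "energy c < s\<^sup>2" for c s
      proof -
        define E where "E = {x. norm (c x) \<le> s / sqrt p}"
        have E: "E \<in> sets borel" "measure \<mu> (- E) < p"
          unfolding E_def by (rule markov_energy[OF c s p])+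
        have "\<not> U \<subseteq> - E"
        proof
          assume "U \<subseteq> - E"
          then have "p \<le> measure \<mu> (- E)"
            unfolding p_def using E(1) sets_mu by (intro mu.finite_measure_mono) auto
          with E(2) show False by simp
        qed
        then obtain v where v: "v \<in> V" "norm (c (x + v)) \<le> s / sqrt p"
          by (auto simp: U_def E_def)
        have "norm (c x) \<le> norm (c (x + v)) + norm (c v)"
          using norm_cocycle_diff[OF c, of "x + v" v] by (simp add: add.assoc)
        also have "\<dots> \<le> s / sqrt p + C0 * s"
          using v C0(2)[OF c s] by (intro add_mono)
        finally show ?thesis by (simp add: algebra_simps)
      qed
      moreover have "1 / sqrt p + C0 \<ge> 0" using p C0(1) by simp
      ultimately show "x \<in> H" unfolding H_def by blast
    qed
    show "0 \<in> H"
      unfolding H_def by (auto intro!: exI[of _ 0] simp: cocycle_zero)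
    show "x + y \<in> H" if "x \<in> H" "y \<in> H" for x y
    proof -
      obtain C D where C: "C \<ge> 0" "\<forall>c\<in>cocycles \<pi>. \<forall>s>0. energy c < s\<^sup>2 \<longrightarrow> norm (c x) \<le> C * s"
        and D: "D \<ge> 0" "\<forall>c\<in>cocycles \<pi>. \<forall>s>0. energy c < s\<^sup>2 \<longrightarrow> norm (c y) \<le> D * s"
        using \<open>x \<in> H\<close> \<open>y \<in> H\<close> unfolding H_def by blast
      have "norm (c (x + y)) \<le> (C + D) * s"
        if "c \<in> cocycles \<pi>" "s > 0" "energy c < s\<^sup>2" for c s
        using norm_cocycle_add[OF that(1), of x y] C(2) D(2) that by (fastforce simp: distrib_right)
      with C(1) D(1) show ?thesis
        unfolding H_def by (intro CollectI exI[of _ "C + D"]) auto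
    qed
    show "- x \<in> H" if "x \<in> H" for x
      using that unfolding H_def by (simp add: norm_cocycle_minus cong: ball_cong)
  qed
  then show ?thesis
    using that unfolding H_def by blast
qed

lemma bounded_on_compact:
  assumes "compact K"
  obtains C where "C \<ge> 0"
    "\<And>c s x. c \<in> cocycles \<pi> \<Longrightarrow> s > 0 \<Longrightarrow> energy c < s\<^sup>2 \<Longrightarrow> x \<in> K \<Longrightarrow> norm (c x) \<le> C * s"
proof -
  obtain V C0 where V: "open V" "0 \<in> V" and C0: "C0 \<ge> 0"
    "\<And>c s x. c \<in> cocycles \<pi> \<Longrightarrow> s > 0 \<Longrightarrow> energy c < s\<^sup>2 \<Longrightarrow> x \<in> V \<Longrightarrow> norm (c x) \<le> C0 * s"
    using bounded_near_zero by metis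
  have "\<exists>C\<ge>0. \<forall>c s. c \<in> cocycles \<pi> \<longrightarrow> s > 0 \<longrightarrow> energy c < s\<^sup>2 \<longrightarrow> norm (c x) \<le> C * s" for x
    using bounded_at_point[of x] by metis
  then obtain C1 where C1: "\<And>x. C1 x \<ge> 0"
    "\<And>c s x. c \<in> cocycles \<pi> \<Longrightarrow> s > 0 \<Longrightarrow> energy c < s\<^sup>2 \<Longrightarrow> norm (c x) \<le> C1 x * s"
    by metis
  have cover: "K \<subseteq> (\<Union>x\<in>K. (\<lambda>v. x + v) ` V)"
    using V(2) by force
  obtain F where F: "F \<subseteq> K" "finite F" "K \<subseteq> (\<Union>x\<in>F. (\<lambda>v. x + v) ` V)"
    by (rule compactE_image[OF assms open_translation[OF V(1)] cover])
  show ?thesis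
  proof
    show "(\<Sum>x\<in>F. C1 x) + C0 \<ge> 0"
      using C0(1) C1(1) by (simp add: sum_nonneg)
    fix c s x assume c: "c \<in> cocycles \<pi>" and s: "s > 0" "energy c < s\<^sup>2" and "x \<in> K"
    then obtain y v where yv: "y \<in> F" "v \<in> V" "x = y + v"
      using F(3) by blast
    have "norm (c x) \<le> norm (c y) + norm (c v)"
      unfolding yv(3) by (rule norm_cocycle_add[OF c])
    also have "\<dots> \<le> C1 y * s + C0 * s"
      by (intro add_mono C1(2) C0(2) c s yv)
    also have "C1 y \<le> (\<Sum>x\<in>F. C1 x)"
      using F(2) C1(1) yv(1) by (intro member_le_sum) auto
    finally show "norm (c x) \<le> ((\<Sum>x\<in>F. C1 x) + C0) * s"
      using s(1) by (simp add: distrib_right mult_right_mono)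
  qed
qed

lemma energy_eq_0_imp_zero:
  assumes c: "c \<in> cocycles \<pi>" and "energy c = 0"
  shows "c x = 0"
proof -
  obtain C where C: "C \<ge> 0" "\<And>s. s > 0 \<Longrightarrow> norm (c x) \<le> C * s"
    using bounded_at_point[of x] assms by (metis zero_less_power)
  have "norm (c x) \<le> 0 + e" if "e > 0" for e
  proof -
    have "norm (c x) \<le> C * (e / (C + 1))"
      using C that by (intro C(2)) auto
    also have "\<dots> \<le> e"
      using C(1) that by (simp add: field_simps)
    finally show ?thesis by simp
  qed
  then have "norm (c x) \<le> 0" by (rule field_le_epsilon)
  then show ?thesis by simp
qed

lemma uniformly_convergent_energy_Cauchy:
  assumes c: "\<And>n. c n \<in> cocycles \<pi>" and K: "compact K"
    and Cauchy: "\<And>e. e > 0 \<Longrightarrow> \<exists>N. \<forall>m\<ge>N. \<forall>n\<ge>N. energy (\<lambda>x. c m x - c n x) < e"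
  shows "uniform_limit K c (\<lambda>x. lim (\<lambda>n. c n x)) sequentially"
proof -
  obtain C where C: "C \<ge> 0"
    "\<And>c s x. c \<in> cocycles \<pi> \<Longrightarrow> s > 0 \<Longrightarrow> energy c < s\<^sup>2 \<Longrightarrow> x \<in> K \<Longrightarrow> norm (c x) \<le> C * s"
    using bounded_on_compact[OF K] by metis
  have "uniformly_Cauchy_on K c"
  proof (rule uniformly_Cauchy_onI)
    fix e :: real assume e: "e > 0"
    define s where "s = e / (C + 1)"
    have s: "s > 0" using e C(1) by (simp add: s_def)
    obtain N where N: "\<forall>m\<ge>N. \<forall>n\<ge>N. energy (\<lambda>x. c m x - c n x) < s\<^sup>2"
      using Cauchy[of "s\<^sup>2"] s by auto
    have "C * s < e"
      using e C(1) by (simp add: s_def field_simps)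
    then have "dist (c m x) (c n x) < e" if "x \<in> K" "m \<ge> N" "n \<ge> N" for x m n
      using C(2)[OF cocycles_diff[OF c c] s, of m n x] N that by (fastforce simp: dist_norm)
    then show "\<exists>M. \<forall>x\<in>K. \<forall>m\<ge>M. \<forall>n\<ge>M. dist (c m x) (c n x) < e" by blast
  qed
  then show ?thesis
    by (simp add: Cauchy_uniformly_convergent flip: uniformly_convergent_uniform_limit_iff)
qed

end

section \<open>Harmonic cocycles\<close>

context adapted_representation
begin

text \<open>
  Since \<open>\<pi> x\<close> is orthogonal and \<open>\<pi> (- x) (c x) = - c (- x)\<close>, the integrand is
  \<open>- c (- x) \<bullet> v - c x \<bullet> v\<close>, and both terms have the same integral as \<open>\<mu>\<close> is symmetric.
\<close>

lemma integral_inner_coboundary: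
  assumes c: "c \<in> cocycles \<pi>"
  shows "(LINT x|\<mu>. c x \<bullet> coboundary \<pi> v x) = - 2 * (LINT x|\<mu>. c x \<bullet> v)"
proof -
  have cont: "continuous_on UNIV (\<lambda>x. c x \<bullet> v)"
    using cocycle_continuous[OF c] by (intro continuous_intros)
  have distr: "distr \<mu> borel uminus = \<mu>"
    using adapted by (simp add: cohomologically_adapted_def)
  have minus: "uminus \<in> measurable \<mu> borel"
    by (intro continuous_measurable continuous_intros)
  have int_minus: "integrable \<mu> (\<lambda>x. c (- x) \<bullet> v)"
    using integrable_inner_const[OF c, of v]
    by (subst (asm) distr[symmetric], subst (asm) integrable_distr_eq[OF minus])
      (use borel_measurable_continuous_onI[OF cont] in auto)
  have "(LINT x|\<mu>. c x \<bullet> v) = (LINT x|distr \<mu> borel uminus. c x \<bullet> v)"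
    by (simp add: distr)
  also have "\<dots> = (LINT x|\<mu>. c (- x) \<bullet> v)"
    by (rule integral_distr[OF minus borel_measurable_continuous_onI[OF cont]])
  finally have eq: "(LINT x|\<mu>. c (- x) \<bullet> v) = (LINT x|\<mu>. c x \<bullet> v)" ..
  have "c x \<bullet> coboundary \<pi> v x = - (c (- x) \<bullet> v) - c x \<bullet> v" for x
    using rep_inner_left[of "- x" "c x" v]
    by (simp add: coboundary_def inner_diff_right cocycle_minus[OF c])
  then show ?thesis
    using int_minus integrable_inner_const[OF c, of v] by (simp add: eq)
qed

lemma harmonic_orthogonal:
  assumes "c \<in> harmonic_cocycles \<mu> \<pi>"
  shows "c \<in> cocycles \<pi>" and "(LINT x|\<mu>. c x \<bullet> v) = 0"
  using assms has_vector_integral_inner[of \<mu> c 0 v]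
  by (auto simp: harmonic_cocycles_def dest: has_bochner_integral_integral_eq)

text \<open>
  The mean of \<open>c\<close> exists and lies in \<open>W\<close>, so it vanishes once it is orthogonal to \<open>W\<close>.
\<close>

lemma harmonicI:
  assumes c: "c \<in> cocycles \<pi>" and W: "Real_Vector_Spaces.subspace W" "closed W" "range c \<subseteq> W"
    and orth: "\<And>w. w \<in> W \<Longrightarrow> (LINT x|\<mu>. c x \<bullet> w) = 0"
  shows "c \<in> harmonic_cocycles \<mu> \<pi>"
proof -
  obtain m where m: "m \<in> W" "has_vector_integral \<mu> c m"
    by (rule vector_integral_in_closed_subspace[OF sets_mu mu.finite_measure_axioms
          cocycle_continuous[OF c] compact_set_power[OF compact_Q] incseq_set_power[OF zero_in_Q]
          Union_set_power[OF generating] cocycle_norm_integrable[OF c] W])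
  have "m \<bullet> m = 0"
    using has_bochner_integral_integral_eq[OF has_vector_integral_inner[OF m(2), of m]] orth[OF m(1)]
    by simp
  with m(2) c show ?thesis by (simp add: harmonic_cocycles_def)
qed

lemma harmonic_iff:
  "c \<in> harmonic_cocycles \<mu> \<pi> \<longleftrightarrow> c \<in> cocycles \<pi> \<and> (\<forall>v. (LINT x|\<mu>. c x \<bullet> v) = 0)"
  using harmonic_orthogonal harmonicI[of c UNIV] by (auto simp: Real_Vector_Spaces.subspace_UNIV)

lemma harmonic_diff:
  assumes "c \<in> harmonic_cocycles \<mu> \<pi>" "d \<in> harmonic_cocycles \<mu> \<pi>"
  shows "(\<lambda>x. c x - d x) \<in> harmonic_cocycles \<mu> \<pi>"
  using assms by (auto simp: harmonic_iff inner_diff_left integrable_inner_const intro: cocycles_diff)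

lemma harmonic_smul:
  assumes "c \<in> harmonic_cocycles \<mu> \<pi>"
  shows "(\<lambda>x. smul a (c x)) \<in> harmonic_cocycles \<mu> \<pi>"
  using assms by (auto simp: harmonic_iff inner_smul_left intro: cocycles_smul)

text \<open>
  The harmonic part of \<open>b\<close>: minimise the energy of \<open>b + \<partial> v\<close> over \<open>v \<in> W\<close>.  A minimising
  sequence need not converge in \<open>W\<close>, but its coboundaries do, uniformly on compact sets.  Staying inside an invariant
  subspace \<open>W\<close> during the minimisation is what later shows that the harmonic part cannot leave \<open>W\<close>.
\<close>

lemma harmonic_part_exists:
  assumes b: "b \<in> cocycles \<pi>" "range b \<subseteq> W"
    and W: "Real_Vector_Spaces.subspace W" "closed W" "\<And>g w. w \<in> W \<Longrightarrow> \<pi> g w \<in> W"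
  obtains P v where "P \<in> harmonic_cocycles \<mu> \<pi>" "range P \<subseteq> W"
    "\<And>K. compact K \<Longrightarrow> uniform_limit K (\<lambda>n. coboundary \<pi> (v n)) (\<lambda>x. P x - b x) sequentially"
proof -
  define B where "B v w = (LINT x|\<mu>. coboundary \<pi> v x \<bullet> coboundary \<pi> w x)" for v w
  define L where "L v = (LINT x|\<mu>. b x \<bullet> coboundary \<pi> v x)" for v
  note int = integrable_inner_cocycles[OF cocycles_coboundary cocycles_coboundary]
    integrable_inner_cocycles[OF b(1) cocycles_coboundary]
  have linB: "linear (\<lambda>v. B v w)" for w
    by (rule linearI) (simp_all add: B_def coboundary_add coboundary_scaleR inner_add_left int)
  have linL: "linear L"
    by (rule linearI) (simp_all add: L_def coboundary_add coboundary_scaleR inner_add_right int)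
  have symB: "B v w = B w v" for v w
    by (simp add: B_def inner_commute)
  have posB: "0 \<le> B v v" for v
    using energy_nonneg[of "coboundary \<pi> v"] by (simp add: B_def energy_inner)
  have bdd: "0 \<le> energy b + 2 * L v + B v v" for v
    using energy_nonneg[of "\<lambda>x. b x + coboundary \<pi> v x"]
    by (simp add: energy_add[OF b(1) cocycles_coboundary] L_def B_def energy_inner[of "coboundary \<pi> v"])
  obtain v where v: "\<And>n. v n \<in> W"
    and Cauchy: "\<And>e. e > 0 \<Longrightarrow> \<exists>N. \<forall>m\<ge>N. \<forall>n\<ge>N. B (v m - v n) (v m - v n) < e"
    and deriv: "\<And>w. w \<in> W \<Longrightarrow> (\<lambda>n. L w + B (v n) w) \<longlonglongrightarrow> 0"
    using quadratic_minimizing_sequence[OF W(1) linL linB symB posB, of "energy b"] bdd by metis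
  define z where "z x = lim (\<lambda>n. coboundary \<pi> (v n) x)" for x
  have "energy (\<lambda>x. coboundary \<pi> (v m) x - coboundary \<pi> (v n) x) = B (v m - v n) (v m - v n)" for m n
    by (simp add: B_def energy_inner coboundary_diff)
  with Cauchy have unif: "uniform_limit K (\<lambda>n. coboundary \<pi> (v n)) z sequentially" if "compact K" for K
    unfolding z_def using that by (intro uniformly_convergent_energy_Cauchy cocycles_coboundary) auto
  have z: "z \<in> cocycles \<pi>"
    by (rule cocycles_uniform_limit[OF compact_Q zero_interior_Q cocycles_coboundary unif])
  have zW: "z x \<in> W" for x
  proof (rule closed_sequentially[OF W(2)])
    show "coboundary \<pi> (v n) x \<in> W" for n
      unfolding coboundary_def by (intro Real_Vector_Spaces.subspace_diff W v)
    show "(\<lambda>n. coboundary \<pi> (v n) x) \<longlonglongrightarrow> z x"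
      using unif[of "{x}"] by (rule tendsto_uniform_limitI) auto
  qed
  define P where "P x = b x + z x" for x
  have P: "P \<in> cocycles \<pi>"
    unfolding P_def by (rule cocycles_add[OF b(1) z])
  have PW: "range P \<subseteq> W"
    using b(2) zW by (auto simp: P_def intro!: Real_Vector_Spaces.subspace_add W(1))
  have "(LINT x|\<mu>. P x \<bullet> w) = 0" if w: "w \<in> W" for w
  proof -
    have "(\<lambda>n. L w + B (v n) w) \<longlonglongrightarrow> L w + (LINT x|\<mu>. z x \<bullet> coboundary \<pi> w x)"
      unfolding B_def
      by (intro tendsto_add tendsto_const integral_inner_uniform_limit cocycles_coboundary z unif compact_Q)
    then have "L w + (LINT x|\<mu>. z x \<bullet> coboundary \<pi> w x) = 0"
      using deriv[OF w] by (rule LIMSEQ_unique)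
    then have "(LINT x|\<mu>. P x \<bullet> coboundary \<pi> w x) = 0"
      by (simp add: P_def L_def inner_add_left int integrable_inner_cocycles[OF z cocycles_coboundary])
    then show ?thesis
      by (simp add: integral_inner_coboundary[OF P])
  qed
  then have "P \<in> harmonic_cocycles \<mu> \<pi>"
    by (rule harmonicI[OF P W(1,2) PW])
  moreover have "z = (\<lambda>x. P x - b x)" by (simp add: P_def fun_eq_iff)
  ultimately show ?thesis
    using PW unif that by auto
qed

text \<open>
  The real inner product is the real part of \<open>ip\<close>.  Replacing \<open>h\<close> by \<open>Z h\<close>, where \<open>Z\<close> is the scalar
  product of \<open>F\<close> and \<open>h\<close>, turns \<open>Z\<close> into \<open>(norm Z)\<^sup>2\<close>, which is determined by its real part.
\<close>

lemma l2_orthogonal_iff: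
  assumes F: "F \<in> cocycles \<pi>"
  shows "(\<forall>h\<in>harmonic_cocycles \<mu> \<pi>. l2_inner ip \<mu> F h = 0) \<longleftrightarrow>
    (\<forall>h\<in>harmonic_cocycles \<mu> \<pi>. (LINT x|\<mu>. F x \<bullet> h x) = 0)"
proof -
  have re: "of_real (2 * (LINT x|\<mu>. F x \<bullet> h x)) = l2_inner ip \<mu> F h + scalar_cnj (l2_inner ip \<mu> F h)"
    if h: "h \<in> cocycles \<pi>" for h
  proof -
    note int = integrable_ip_cocycles[OF F h]
    have cnj: "ip (h x) (F x) = scalar_cnj (ip (F x) (h x))" for x
      by (rule ip_commute)
    have "(of_real (2 * (LINT x|\<mu>. F x \<bullet> h x)) :: 'k) = of_real (LINT x|\<mu>. 2 * (F x \<bullet> h x))"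
      by simp
    also have "\<dots> = (LINT x|\<mu>. of_real (2 * (F x \<bullet> h x)))"
      using integrable_inner_cocycles[OF F h]
      by (intro integral_bounded_linear[symmetric] bounded_linear_of_real integrable_mult_right)
    also have "\<dots> = (LINT x|\<mu>. ip (F x) (h x) + scalar_cnj (ip (F x) (h x)))"
      by (simp only: of_real_inner cnj)
    also have "\<dots> = l2_inner ip \<mu> F h + scalar_cnj (l2_inner ip \<mu> F h)"
      unfolding l2_inner_def
      using int integrable_bounded_linear[OF bounded_linear_scalar_cnj int]
      by (simp add: integral_bounded_linear[OF bounded_linear_scalar_cnj int])
    finally show ?thesis .
  qed
  show ?thesis
  proof (intro iffI ballI)
    fix h assume "\<forall>h\<in>harmonic_cocycles \<mu> \<pi>. l2_inner ip \<mu> F h = 0" and h: "h \<in> harmonic_cocycles \<mu> \<pi>"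
    then have "l2_inner ip \<mu> F h = 0" by blast
    then have "(of_real (2 * (LINT x|\<mu>. F x \<bullet> h x)) :: 'k) = of_real 0"
      unfolding re[OF harmonic_orthogonal(1)[OF h]]
      using scalar_cnj_of_real[of 0] by simp
    then show "(LINT x|\<mu>. F x \<bullet> h x) = 0"
      unfolding of_real_eq_iff by simp
  next
    fix h assume *: "\<forall>h\<in>harmonic_cocycles \<mu> \<pi>. (LINT x|\<mu>. F x \<bullet> h x) = 0"
      and h: "h \<in> harmonic_cocycles \<mu> \<pi>"
    define Z where "Z = l2_inner ip \<mu> F h"
    define h' where "h' x = smul Z (h x)" for x
    have h': "h' \<in> harmonic_cocycles \<mu> \<pi>"
      unfolding h'_def by (rule harmonic_smul[OF h])
    have "l2_inner ip \<mu> F h' = scalar_cnj Z * Z"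
      by (simp add: l2_inner_def h'_def ip_scale_right Z_def)
    then have "l2_inner ip \<mu> F h' = of_real ((norm Z)\<^sup>2)"
      by (simp only: scalar_cnj_norm_square)
    with re[OF harmonic_orthogonal(1)[OF h']] * h'
    have "of_real ((norm Z)\<^sup>2) + of_real ((norm Z)\<^sup>2) = (of_real 0 :: 'k)"
      by (simp add: scalar_cnj_of_real del: of_real_power)
    then have "(norm Z)\<^sup>2 + (norm Z)\<^sup>2 = 0"
      unfolding of_real_add[symmetric] of_real_eq_iff .
    then show "l2_inner ip \<mu> F h = 0"
      by (simp add: Z_def)
  qed
qed

text \<open>
  A harmonic cocycle that differs from \<open>b\<close> by a limit of coboundaries is the projection of \<open>b\<close>:
  such limits are orthogonal to the harmonic cocycles, and a cocycle of energy zero vanishes.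
\<close>

lemma harmonic_projection_eqI:
  assumes b: "b \<in> cocycles \<pi>" and P: "P \<in> harmonic_cocycles \<mu> \<pi>"
    and lim: "uniform_limit Q (\<lambda>n. coboundary \<pi> (v n)) (\<lambda>x. P x - b x) sequentially"
  shows "harmonic_projection ip \<mu> \<pi> b = P"
  unfolding harmonic_projection_def
proof (rule the_equality)
  note Pc = harmonic_orthogonal(1)[OF P]
  have orth: "(LINT x|\<mu>. (P x - b x) \<bullet> h x) = 0" if h: "h \<in> harmonic_cocycles \<mu> \<pi>" for h
  proof -
    note hc = harmonic_orthogonal(1)[OF h]
    have "(LINT x|\<mu>. coboundary \<pi> (v n) x \<bullet> h x) = 0" for n
      using integral_inner_coboundary[OF hc, of "v n"] harmonic_orthogonal(2)[OF h]
      by (simp add: inner_commute)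
    then show ?thesis
      using integral_inner_uniform_limit[OF cocycles_coboundary cocycles_diff[OF Pc b] hc lim]
      by (simp add: LIMSEQ_const_iff)
  qed
  have orth': "(LINT x|\<mu>. (b x - P x) \<bullet> h x) = 0" if "h \<in> harmonic_cocycles \<mu> \<pi>" for h
    using orth[OF that] integral_minus[of \<mu> "\<lambda>x. (P x - b x) \<bullet> h x"]
    by (simp add: inner_minus_left[symmetric])
  show "P \<in> harmonic_cocycles \<mu> \<pi> \<and>
      (\<forall>h\<in>harmonic_cocycles \<mu> \<pi>. l2_inner ip \<mu> (\<lambda>x. b x - P x) h = 0)"
    using P orth' unfolding l2_orthogonal_iff[OF cocycles_diff[OF b Pc]] by blast
  fix P' assume P': "P' \<in> harmonic_cocycles \<mu> \<pi> \<and>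
      (\<forall>h\<in>harmonic_cocycles \<mu> \<pi>. l2_inner ip \<mu> (\<lambda>x. b x - P' x) h = 0)"
  then have P'c: "P' \<in> cocycles \<pi>" using harmonic_orthogonal(1) by blast
  define h where "h x = P' x - P x" for x
  have h: "h \<in> harmonic_cocycles \<mu> \<pi>"
    unfolding h_def using P P' by (intro harmonic_diff) auto
  note hc = harmonic_orthogonal(1)[OF h]
  have "(LINT x|\<mu>. (b x - P' x) \<bullet> h x) = 0"
    using P' h unfolding l2_orthogonal_iff[OF cocycles_diff[OF b P'c]] by blast
  moreover have "energy h = (LINT x|\<mu>. (b x - P x) \<bullet> h x - (b x - P' x) \<bullet> h x)"
    unfolding energy_inner by (simp add: h_def inner_diff_left[symmetric])
  ultimately have "energy h = 0"
    using orth'[OF h] integrable_inner_cocycles[OF cocycles_diff[OF b Pc] hc]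
      integrable_inner_cocycles[OF cocycles_diff[OF b P'c] hc]
    by simp
  from energy_eq_0_imp_zero[OF hc this] show "P' = P"
    by (simp add: h_def fun_eq_iff)
qed

section \<open>Irreducibility\<close>

theorem irreducible_if_dense:
  assumes b: "b \<in> cocycles \<pi>"
    and dense: "closure (span (range (harmonic_projection ip \<mu> \<pi> b))) = UNIV"
  shows "irreducible_action smul (affine_action \<pi> b)"
  unfolding irreducible_action_def
proof (rule notI, elim exE conjE)
  fix A
  assume A: "affine_subspace smul A" "A \<noteq> {}" "closed A" "A \<noteq> UNIV"
    and inv: "\<forall>g. affine_action \<pi> b g ` A \<subseteq> A"
  obtain v W where W: "subspace W" and A_eq: "A = (\<lambda>w. v + w) ` W"
    using A(1) by (auto simp: affine_subspace_def)
  have mem: "v + w \<in> A \<longleftrightarrow> w \<in> W" for w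
    by (auto simp: A_eq)
  have "closed W"
  proof -
    have "W = (\<lambda>w. v + w) -` A" using mem by auto
    also have "closed \<dots>"
      by (intro closed_vimage A(3) continuous_intros)
    finally show ?thesis .
  qed
  \<comment> \<open>Moving the base point to \<open>v\<close> replaces \<open>b\<close> by \<open>\<beta>\<close>.\<close>
  define \<beta> where "\<beta> g = b g + coboundary \<pi> v g" for g
  have \<beta>: "\<beta> \<in> cocycles \<pi>"
    unfolding \<beta>_def by (rule cocycles_add[OF b cocycles_coboundary])
  have shift: "\<beta> g + \<pi> g w \<in> W" if "w \<in> W" for g w
  proof -
    have "affine_action \<pi> b g (v + w) \<in> A"
      using inv mem that by blast
    also have "affine_action \<pi> b g (v + w) = v + (\<beta> g + \<pi> g w)"
      by (simp add: affine_action_def \<beta>_def coboundary_def rep_add_vec)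
    finally show ?thesis unfolding mem .
  qed
  have \<beta>W: "\<beta> g \<in> W" for g
    using shift[OF subspace_0[OF W], of g] linear_0[OF bounded_linear.linear[OF bounded_linear_rep]]
    by simp
  have invW: "\<pi> g w \<in> W" if "w \<in> W" for g w
    using subspace_diff[OF W shift[OF that, of g] \<beta>W[of g]] by simp
  obtain P u where P: "P \<in> harmonic_cocycles \<mu> \<pi>" "range P \<subseteq> W"
    and lim: "\<And>K. compact K \<Longrightarrow> uniform_limit K (\<lambda>n. coboundary \<pi> (u n)) (\<lambda>x. P x - \<beta> x) sequentially"
    by (rule harmonic_part_exists[OF \<beta> _ real_subspace[OF W] \<open>closed W\<close> invW])
      (use \<beta>W in \<open>auto\<close>)
  have "uniform_limit Q (\<lambda>n. coboundary \<pi> (u n + v)) (\<lambda>x. P x - b x) sequentially"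
    using lim[OF compact_Q]
    by (simp add: uniform_limit_iff \<beta>_def coboundary_add dist_norm algebra_simps)
  then have "harmonic_projection ip \<mu> \<pi> b = P"
    by (rule harmonic_projection_eqI[OF b P(1)])
  with P(2) have "closure (span (range (harmonic_projection ip \<mu> \<pi> b))) \<subseteq> W"
    using W \<open>closed W\<close> by (simp add: closure_minimal span_minimal)
  then have "W = UNIV" using dense by auto
  then have "x \<in> A" for x
    using mem[of "x - v"] by simp
  with A(4) show False by auto
qed

theorem dense_if_irreducible:
  assumes b: "b \<in> cocycles \<pi>"
    and closed: "closedin (subtopology compact_convergence_topology (cocycles \<pi>)) (coboundaries \<pi>)"
    and irr: "irreducible_action smul (affine_action \<pi> b)"
  shows "closure (span (range (harmonic_projection ip \<mu> \<pi> b))) = UNIV"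
proof -
  obtain P v where P: "P \<in> harmonic_cocycles \<mu> \<pi>"
    and lim: "\<And>K. compact K \<Longrightarrow> uniform_limit K (\<lambda>n. coboundary \<pi> (v n)) (\<lambda>x. P x - b x) sequentially"
    using harmonic_part_exists[OF b, of UNIV] by (auto simp: Real_Vector_Spaces.subspace_UNIV)
  note Pc = harmonic_orthogonal(1)[OF P]
  have proj: "harmonic_projection ip \<mu> \<pi> b = P"
    by (rule harmonic_projection_eqI[OF b P lim[OF compact_Q]])
  define z where "z x = P x - b x" for x
  have z: "z \<in> cocycles \<pi>"
    unfolding z_def by (rule cocycles_diff[OF Pc b])
  have "z \<in> coboundaries \<pi>"
  proof (rule ccontr)
    assume z': "z \<notin> coboundaries \<pi>"
    have top: "topspace compact_convergence_topology = (UNIV :: ('g \<Rightarrow> 'h) set)"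
    proof -
      have "openin compact_convergence_topology (UNIV :: ('g \<Rightarrow> 'h) set)"
        unfolding openin_compact_convergence_topology
        by (intro ballI exI[of _ "{}"] exI[of _ 1]) simp
      then show ?thesis by (metis openin_subset top.extremum_unique)
    qed
    obtain U where U: "openin compact_convergence_topology U"
      "cocycles \<pi> - coboundaries \<pi> = U \<inter> cocycles \<pi>"
      using closed by (auto simp: closedin_def openin_subtopology top)
    \<comment> \<open>A coboundary close to \<open>z\<close> on a compact set lies in \<open>U\<close>, which contains none.\<close>
    have "z \<in> U" using U(2) z z' by blast
    from bspec[OF U(1)[unfolded openin_compact_convergence_topology] this]
    obtain K e where K: "compact K" "e > 0" "{f'. \<forall>x\<in>K. dist (f' x) (z x) < e} \<subseteq> U"
      by (elim exE conjE)
    have "\<forall>\<^sub>F n in sequentially. \<forall>x\<in>K. dist (coboundary \<pi> (v n) x) (z x) < e"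
      using lim[OF K(1)] K(2) unfolding uniform_limit_iff z_def by blast
    then obtain n where "\<forall>x\<in>K. dist (coboundary \<pi> (v n) x) (z x) < e"
      by (auto simp: eventually_sequentially)
    then have "coboundary \<pi> (v n) \<in> U \<inter> cocycles \<pi>"
      using K(3) cocycles_coboundary by blast
    then show False
      using U(2) by (auto simp: coboundaries_def)
  qed
  then obtain w where w: "z = coboundary \<pi> w"
    by (auto simp: coboundaries_def)
  have b_eq: "b g = P g - (\<pi> g w - w)" for g
    using fun_cong[OF w, of g] by (simp add: z_def coboundary_def algebra_simps)
  define W where "W = closure (span (range P))"
  have W: "subspace W" "closed W"
    unfolding W_def by (simp_all add: subspace_closure subspace_span)
  have PW: "P g \<in> W" for g
    unfolding W_def by (intro subsetD[OF closure_subset] span_base) simp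
  have span_inv: "\<pi> g x \<in> span (range P)" if "x \<in> span (range P)" for g x
    using that
  proof (induction rule: span_induct_alt)
    case base
    then show ?case
      using linear_0[OF bounded_linear.linear[OF bounded_linear_rep]] by (simp add: span_zero)
  next
    case (step c x y)
    then obtain h where x: "x = P h" by auto
    have "\<pi> g x = P (g + h) - P g"
      by (simp add: x cocycle_add_group[OF Pc])
    also have "\<dots> \<in> span (range P)"
      by (intro span_diff span_base) auto
    finally show ?case
      using step by (simp add: rep_add_vec rep_smul span_add span_scale)
  qed
  have invW: "\<pi> g x \<in> W" if x: "x \<in> W" for g x
  proof -
    obtain f where f: "\<And>n. f n \<in> span (range P)" "f \<longlonglongrightarrow> x"
      using x unfolding W_def closure_sequential by blast
    have "(\<lambda>n. \<pi> g (f n)) \<longlonglongrightarrow> \<pi> g x"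
      by (rule bounded_linear.tendsto[OF bounded_linear_rep f(2)])
    with span_inv[OF f(1)] show ?thesis
      unfolding W_def closure_sequential by (intro exI[of _ "\<lambda>n. \<pi> g (f n)"]) simp
  qed
  define A where "A = (\<lambda>x. w + x) ` W"
  have mem: "w + x \<in> A \<longleftrightarrow> x \<in> W" for x
    by (auto simp: A_def)
  have "affine_subspace smul A"
    using W(1) unfolding affine_subspace_def A_def by blast
  moreover have "A \<noteq> {}"
    using subspace_0[OF W(1)] by (auto simp: A_def)
  moreover have "closed A"
    unfolding A_def by (rule closed_translation[OF W(2)])
  moreover have "affine_action \<pi> b g ` A \<subseteq> A" for g
  proof
    fix y assume "y \<in> affine_action \<pi> b g ` A"
    then obtain x where x: "x \<in> W" "y = affine_action \<pi> b g (w + x)"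
      by (auto simp: A_def)
    have "y = w + (\<pi> g x + P g)"
      by (simp add: x(2) affine_action_def b_eq rep_add_vec)
    then show "y \<in> A"
      by (simp add: mem subspace_add[OF W(1) invW[OF x(1)] PW])
  qed
  ultimately have "A = UNIV"
    using irr unfolding irreducible_action_def by blast
  then have "x \<in> W" for x
    using mem[of x] by simp
  then show ?thesis
    unfolding proj W_def by auto
qed

end

theorem corollary1:
  fixes smul :: "'k::real_or_complex \<Rightarrow> 'h::{real_inner, banach} \<Rightarrow> 'h"
    and ip :: "'h \<Rightarrow> 'h \<Rightarrow> 'k"
    and \<pi> :: "'g::{topological_group_add, t2_space} \<Rightarrow> 'h \<Rightarrow> 'h"
    and Q :: "'g set"
    and \<mu> :: "'g measure"
    and b :: "'g \<Rightarrow> 'h"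
  assumes "locally_compact_space (euclidean :: 'g topology)"
    and "compactly_generated TYPE('g)"
    and "compact_generating_neighbourhood Q"
    and "unitary_representation smul ip \<pi>"
    and "cohomologically_adapted Q \<mu>"
    and "b \<in> cocycles \<pi>"
  shows
    "(closure (module.span smul (range (harmonic_projection ip \<mu> \<pi> b))) = UNIV \<longrightarrow>
        irreducible_action smul (affine_action \<pi> b)) \<and>
     (closedin (subtopology compact_convergence_topology (cocycles \<pi>)) (coboundaries \<pi>) \<longrightarrow>
        irreducible_action smul (affine_action \<pi> b) \<longrightarrow>
        closure (module.span smul (range (harmonic_projection ip \<mu> \<pi> b))) = UNIV)"
proof -
  interpret unitary_representation smul ip \<pi> by fact
  interpret adapted_representation smul ip \<pi> Q \<mu>
    by unfold_locales fact+
  show ?thesis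
    using irreducible_if_dense dense_if_irreducible assms(6) by blast
qed

end
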